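(* Let $X$ be a Gaussian stationary-increment process, let $A\subset\mathbb R$ be a Borel set, let $\{E_k\}_{k\in J}$, $J\subset\mathbb Z$, be an orthogonal basis of the Gaussian Hilbert space $\mathcal G$ generated by $X$, and let $J_0\subset J$ be such that $\{E_j\}_{j\in J_0}$ is an orthogonal basis of $\mathcal G_A$. Then for every $\alpha\in\mathcal J$, the random variable $H_\alpha$ is measurable with respect to $\mathscr F_A$ if and only if $\alpha\in\mathcal J_0$, i.e. if and only if the support of $\alpha$ is contained in $J_0$.
   Context: $X=\{X(t),\,t\in\mathbb R\}$ is a real, zero-mean, second-order Gaussian process with stationary increments on a probability space $(\Omega,\mathscr F,\mathbb P)$, with spectral measure $\Delta$, a positive measure on $\mathbb R$ with $\int_{\mathbb R}\frac{d\Delta(\gamma)}{1+\gamma^2}<\infty$; that is, $\mathbb E[X(t_1)X(t_2)]=\int_{\mathbb R}\frac{1-e^{i\gamma t_1}}{i\gamma}\,\frac{1-e^{-i\gamma t_2}}{-i\gamma}\,d\Delta(\gamma)$ for all $t_1,t_2\in\mathbb R$. $\mathcal G$ is the (real) closed linear span of $\{X(t),\,t\in\mathbb R\}$ in $L_2(\Omega,\mathscr F,\mathbb P)$. For a Borel set $A\subset\mathbb R$, $\mathcal G_A$ is the closed linear span of $\{X(s),\,s\in A\}$, and $\mathscr F_A$ is the $\sigma$-field generated by $\{X(s),\,s\in A\}$. Random variables are regarded as elements of $L_2(\Omega,\mathscr F,\mathbb P)$, i.e. up to almost sure equality; "measurable with respect to $\mathscr F_A$" means almost surely equal to an $\mathscr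 F_A$-measurable random variable. An orthogonal basis is a complete system of pairwise orthogonal nonzero vectors. $\mathcal J$ is the set of multi-indices over $J$, i.e. functions $\alpha:J\to\{0,1,2,\dots\}$ with finite support, and $\mathcal J_0\subset\mathcal J$ is the set of those whose support is contained in $J_0$. For $\alpha\in\mathcal J$, $$H_\alpha(\omega)=\prod_{j\in J}h_{\alpha_j}(E_j(\omega)),\qquad h_n(x)=n!\sum_{m=0}^{\lfloor n/2\rfloor}\frac{x^{n-2m}(-1/2)^m}{m!\,(n-2m)!}.$$ *)

theory Defs
  imports "HOL-Probability.Probability"
begin

text \<open>
  Elements of \<open>L\<^sub>2(M)\<close> are represented by measurable functions; every notion below
  that refers to \<open>L\<^sub>2(M)\<close> is invariant under almost sure equality.
\<close>

definition L2 :: "'a measure \<Rightarrow> ('a \<Rightarrow> real) set" where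
  "L2 M = {f \<in> borel_measurable M. integrable M (\<lambda>\<omega>. (f \<omega>)\<^sup>2)}"

text \<open>
  Real closed linear span in \<open>L\<^sub>2(M)\<close> of the family \<open>F\<close> indexed by \<open>I\<close>, meant for families in
  \<open>L2 M\<close> (otherwise the integral may default to \<open>0\<close>). It contains all
  representatives of its elements; the empty family spans the almost surely vanishing functions.
\<close>

definition L2_span :: "'a measure \<Rightarrow> ('i \<Rightarrow> 'a \<Rightarrow> real) \<Rightarrow> 'i set \<Rightarrow> ('a \<Rightarrow> real) set" where
  "L2_span M F I = {f \<in> L2 M. \<forall>\<epsilon>>0. \<exists>T c. finite T \<and> T \<subseteq> I \<and>
     sqrt (\<integral>\<omega>. (f \<omega> - (\<Sum>i\<in>T. c i * F i \<omega>))\<^sup>2 \<partial>M) < \<epsilon>}"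

definition orthogonal_basis ::
  "'a measure \<Rightarrow> ('i \<Rightarrow> 'a \<Rightarrow> real) \<Rightarrow> 'i set \<Rightarrow> ('a \<Rightarrow> real) set \<Rightarrow> bool" where
  "orthogonal_basis M E I V \<longleftrightarrow>
     (\<forall>i\<in>I. E i \<in> V \<and> \<not> (AE \<omega> in M. E i \<omega> = 0)) \<and>
     (\<forall>i\<in>I. \<forall>j\<in>I. i \<noteq> j \<longrightarrow> (\<integral>\<omega>. E i \<omega> * E j \<omega> \<partial>M) = 0) \<and>
     L2_span M E I = V"

text \<open>Constants are admitted as degenerate Gaussian variables.\<close>

definition gaussian_rv :: "'a measure \<Rightarrow> ('a \<Rightarrow> real) \<Rightarrow> bool" where
  "gaussian_rv M Y \<longleftrightarrow> Y \<in> borel_measurable M \<and>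
     ((\<exists>\<mu>. AE \<omega> in M. Y \<omega> = \<mu>) \<or>
      (\<exists>\<mu> \<sigma>. \<sigma> > 0 \<and> distributed M lborel Y (\<lambda>x. ennreal (normal_density \<mu> \<sigma> x))))"

definition gaussian_process :: "'a measure \<Rightarrow> (real \<Rightarrow> 'a \<Rightarrow> real) \<Rightarrow> bool" where
  "gaussian_process M X \<longleftrightarrow>
     (\<forall>T c. finite T \<longrightarrow> gaussian_rv M (\<lambda>\<omega>. \<Sum>t\<in>T. c t * X t \<omega>))"

text \<open>The finite-dimensional laws of \<open>t \<mapsto> X(t + h) - X(h)\<close> do not depend on \<open>h\<close>.\<close>

definition stationary_increments :: "'a measure \<Rightarrow> (real \<Rightarrow> 'a \<Rightarrow> real) \<Rightarrow> bool" where
  "stationary_increments M X \<longleftrightarrow>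
     (\<forall>T h. finite T \<longrightarrow>
        distr M (PiM T (\<lambda>_. borel)) (\<lambda>\<omega>. \<lambda>t\<in>T. X (t + h) \<omega> - X h \<omega>) =
        distr M (PiM T (\<lambda>_. borel)) (\<lambda>\<omega>. \<lambda>t\<in>T. X t \<omega> - X 0 \<omega>))"

text \<open>
  The function \<open>(1 - exp(i \<gamma> t)) / (i \<gamma>)\<close>, continuously extended to \<open>\<gamma> = 0\<close>. The value there
  matters because the spectral measure may have an atom at \<open>0\<close>.
\<close>

definition spectral_kernel :: "real \<Rightarrow> real \<Rightarrow> complex" where
  "spectral_kernel t \<gamma> =
     (if \<gamma> = 0 then - of_real t
      else (1 - exp (\<i> * of_real \<gamma> * of_real t)) / (\<i> * of_real \<gamma>))"

text \<open>
  The second factor of the covariance integrand, \<open>(1 - exp(-i \<gamma> t2)) / (-i \<gamma>)\<close>, is the complex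
  conjugate of \<open>spectral_kernel t2 \<gamma>\<close>.
\<close>

locale gaussian_stationary_increment_process = prob_space M
  for M :: "'a measure" and X :: "real \<Rightarrow> 'a \<Rightarrow> real" and \<Delta> :: "real measure" +
  assumes second_order: "\<And>t. X t \<in> L2 M"
    and zero_mean: "\<And>t. expectation (X t) = 0"
    and gaussian: "gaussian_process M X"
    and stationary: "stationary_increments M X"
    and sets_spectral: "sets \<Delta> = sets borel"
    and spectral_finite: "(\<integral>\<^sup>+\<gamma>. ennreal (1 / (1 + \<gamma>\<^sup>2)) \<partial>\<Delta>) < \<infinity>"
    and covariance: "\<And>t1 t2. complex_of_real (expectation (\<lambda>\<omega>. X t1 \<omega> * X t2 \<omega>)) =
           (\<integral>\<gamma>. spectral_kernel t1 \<gamma> * cnj (spectral_kernel t2 \<gamma>) \<partial>\<Delta>)"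

definition generated_sigma :: "'a measure \<Rightarrow> (real \<Rightarrow> 'a \<Rightarrow> real) \<Rightarrow> real set \<Rightarrow> 'a measure" where
  "generated_sigma M X A =
     sigma (space M) {X s -` B \<inter> space M | s B. s \<in> A \<and> B \<in> sets borel}"

text \<open>Almost surely equal to a random variable measurable with respect to \<open>N\<close>.\<close>

definition ae_measurable :: "'a measure \<Rightarrow> 'a measure \<Rightarrow> ('a \<Rightarrow> real) \<Rightarrow> bool" where
  "ae_measurable M N Y \<longleftrightarrow> (\<exists>Z \<in> borel_measurable N. AE \<omega> in M. Y \<omega> = Z \<omega>)"

text \<open>Multi-indices over \<open>J\<close> are extended by zero to all of \<open>\<int>\<close>.\<close>

definition multi_index_support :: "(int \<Rightarrow> nat) \<Rightarrow> int set" where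
  "multi_index_support \<alpha> = {j. \<alpha> j \<noteq> 0}"

definition multi_indices :: "int set \<Rightarrow> (int \<Rightarrow> nat) set" where
  "multi_indices J = {\<alpha>. finite (multi_index_support \<alpha>) \<and> multi_index_support \<alpha> \<subseteq> J}"

definition hermite :: "nat \<Rightarrow> real \<Rightarrow> real" where
  "hermite n x = fact n * (\<Sum>m = 0..n div 2.
      x ^ (n - 2 * m) * (- 1 / 2) ^ m / (fact m * fact (n - 2 * m)))"

text \<open>
  The product over \<open>J\<close> is taken over the support only, since the remaining factors are
  \<open>hermite 0 = 1\<close> and \<open>\<Prod>\<close> over an infinite set is \<open>1\<close> by convention.
\<close>

definition hermite_product :: "(int \<Rightarrow> 'a \<Rightarrow> real) \<Rightarrow> (int \<Rightarrow> nat) \<Rightarrow> 'a \<Rightarrow> real" where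
  "hermite_product E \<alpha> \<omega> = (\<Prod>j\<in>multi_index_support \<alpha>. hermite (\<alpha> j) (E j \<omega>))"

end

theory Submission
  imports Defs
begin

text \<open>
  Every element \<open>f\<close> of the closed span satisfies \<open>E exp(if) = exp(- E f\<^sup>2 / 2)\<close>, because both sides
  are continuous in \<open>L\<^sub>2\<close>. Hence characteristic functions of orthogonal elements of the span
  factorise, and orthogonality implies independence.

  Suppose the support of \<open>\<alpha>\<close> contains some \<open>j\<close> outside \<open>J0\<close>. Then \<open>E j\<close> is orthogonal to, hence
  independent of, all \<open>X s\<close> with \<open>s \<in> A\<close> and all other \<open>E k\<close> with \<open>k\<close> in the support. The remaining
  Hermite factors are almost surely nonzero, so if \<open>H\<^sub>\<alpha>\<close> were measurable for the \<open>\<sigma>\<close>-field of \<open>A\<close>,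
  division would make the nonconstant polynomial \<open>hermite (\<alpha> j) (E j)\<close> almost surely measurable for
  a \<open>\<sigma>\<close>-field independent of \<open>E j\<close>, which is impossible. The converse holds since \<open>L\<^sub>2\<close> limits have
  almost surely convergent subsequences.
\<close>

subsection \<open>Independence from characteristic functions\<close>

context prob_space
begin

text \<open>
  Tilting \<open>M\<close> by the nonnegative density \<open>1 + w / (\<bar>C\<bar> + 1)\<close> does not change the
  characteristic function of \<open>Y\<close>, hence not its law.
\<close>

lemma expectation_indicator_eq_0_if_fourier_real:
  fixes w Y :: "'a \<Rightarrow> real"
  assumes [measurable]: "w \<in> borel_measurable M" "Y \<in> borel_measurable M"
    and bound: "\<And>\<omega>. \<bar>w \<omega>\<bar> \<le> C"
    and fourier: "\<And>s. (CLINT \<omega>|M. of_real (w \<omega>) * iexp (s * Y \<omega>)) = 0"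
    and B [measurable]: "B \<in> sets borel"
  shows "expectation (\<lambda>\<omega>. w \<omega> * indicator B (Y \<omega>)) = 0"
proof -
  define d where "d \<omega> = 1 + w \<omega> / (\<bar>C\<bar> + 1)" for \<omega>
  have [measurable]: "d \<in> borel_measurable M"
    unfolding d_def by measurable
  have "\<bar>w \<omega>\<bar> / (\<bar>C\<bar> + 1) \<le> 1" for \<omega>
    using bound[of \<omega>] by (simp add: field_simps)
  then have "\<bar>w \<omega> / (\<bar>C\<bar> + 1)\<bar> \<le> 1" for \<omega>
    by (simp add: abs_divide)
  then have d0: "d \<omega> \<ge> 0" and d2: "d \<omega> \<le> 2" for \<omega>
    unfolding d_def by (smt (verit))+
  have int_w: "integrable M w"
    by (rule integrable_const_bound[of _ C]) (auto simp: bound)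
  have int_d: "integrable M d"
    by (rule integrable_const_bound[of _ 2]) (auto simp: d0 d2)
  have int_we: "integrable M (\<lambda>\<omega>. of_real (w \<omega>) * iexp (s * Y \<omega>))" for s
    by (rule integrable_const_bound[of _ C]) (auto simp: norm_mult bound)
  have int_e: "integrable M (\<lambda>\<omega>. iexp (s * Y \<omega>))" for s
    by (rule integrable_const_bound[of _ 1]) auto
  \<comment> \<open>Frequency zero says that \<open>w\<close> has mean zero, so the density
    \<open>d\<close> has total mass one and \<open>?D\<close> is again a probability
    measure.\<close>
  have w0: "expectation w = 0"
    using fourier[of 0] by simp
  have d1: "expectation d = 1"
    unfolding d_def using int_w by (simp add: w0 prob_space)
  let ?D = "density M (\<lambda>\<omega>. ennreal (d \<omega>))"
  interpret D: prob_space ?D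
    by standard (simp add: emeasure_density nn_integral_eq_integral[OF int_d] d0 d1)
  have "char (distr ?D borel Y) s = char (distr M borel Y) s" for s
  proof -
    have "char (distr ?D borel Y) s = (CLINT \<omega>|?D. iexp (s * Y \<omega>))"
      unfolding char_def by (subst integral_distr) auto
    also have "\<dots> = (CLINT \<omega>|M. d \<omega> *\<^sub>R iexp (s * Y \<omega>))"
      by (subst integral_density) (auto simp: d0)
    also have "\<dots> = (CLINT \<omega>|M. iexp (s * Y \<omega>) +
        (of_real (w \<omega>) * iexp (s * Y \<omega>)) / of_real (\<bar>C\<bar> + 1))"
      by (intro Bochner_Integration.integral_cong refl)
         (simp add: d_def scaleR_conv_of_real algebra_simps)
    also have "\<dots> = (CLINT \<omega>|M. iexp (s * Y \<omega>)) +
        (CLINT \<omega>|M. of_real (w \<omega>) * iexp (s * Y \<omega>)) / of_real (\<bar>C\<bar> + 1)"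
      by (subst Bochner_Integration.integral_add, rule int_e, rule integrable_divide_zero, rule int_we)
         simp
    also have "\<dots> = char (distr M borel Y) s"
      unfolding char_def by (subst integral_distr) (auto simp: fourier simp del: of_real_mult)
    finally show ?thesis .
  qed
  then have eq: "distr ?D borel Y = distr M borel Y"
    by (intro Levy_uniqueness ext D.real_distribution_distr real_distribution_distr) auto
  have "(\<integral>\<omega>. d \<omega> * indicator B (Y \<omega>) \<partial>M) = (\<integral>x. indicator B x \<partial>distr ?D borel Y)"
    by (subst integral_distr) (auto simp: integral_real_density d0)
  also have "\<dots> = (\<integral>\<omega>. indicator B (Y \<omega>) \<partial>M)"
    unfolding eq by (subst integral_distr) auto
  finally have "(\<integral>\<omega>. d \<omega> * indicator B (Y \<omega>) \<partial>M) = (\<integral>\<omega>. indicator B (Y \<omega>) \<partial>M)" .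
  moreover have "(\<integral>\<omega>. d \<omega> * indicator B (Y \<omega>) \<partial>M) =
      (\<integral>\<omega>. indicator B (Y \<omega>) + w \<omega> * indicator B (Y \<omega>) / (\<bar>C\<bar> + 1) \<partial>M)"
    by (intro Bochner_Integration.integral_cong refl) (simp add: d_def algebra_simps)
  moreover have "integrable M (\<lambda>\<omega>. indicator B (Y \<omega>) :: real)"
    by (rule integrable_const_bound[of _ 1]) (auto simp: indicator_def)
  \<comment> \<open>The bound at any single point, here \<open>undefined\<close>, shows that
    \<open>C\<close> is nonnegative.\<close>
  moreover have "\<bar>C\<bar> = C" using bound[of undefined] by simp
  then have "integrable M (\<lambda>\<omega>. w \<omega> * indicator B (Y \<omega>) / (\<bar>C\<bar> + 1))"
    by (intro integrable_divide_zero integrable_const_bound[of _ C])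
       (auto simp: bound indicator_def intro: order_trans[OF abs_ge_zero bound])
  ultimately show ?thesis
    by auto
qed

text \<open>The complex weight is reduced to the real case: its real and imaginary parts are
  combinations of \<open>w\<close> and its conjugate, and the Fourier integrals against
  \<open>Y\<close> vanish for both.\<close>

lemma expectation_indicator_eq_0_if_fourier:
  fixes w :: "'a \<Rightarrow> complex" and Y :: "'a \<Rightarrow> real"
  assumes [measurable]: "w \<in> borel_measurable M" "Y \<in> borel_measurable M"
    and bound: "\<And>\<omega>. norm (w \<omega>) \<le> C"
    and fourier: "\<And>s. (CLINT \<omega>|M. w \<omega> * iexp (s * Y \<omega>)) = 0"
    and B [measurable]: "B \<in> sets borel"
  shows "(CLINT \<omega>|M. w \<omega> * indicator B (Y \<omega>)) = 0"
proof -
  have [measurable]: "(\<lambda>\<omega>. cnj (w \<omega>)) \<in> borel_measurable M"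
    by (rule borel_measurable_continuous_on[of cnj]) (auto intro: continuous_intros)
  have int: "integrable M (\<lambda>\<omega>. w \<omega> * iexp (s * Y \<omega>))"
    "integrable M (\<lambda>\<omega>. cnj (w \<omega>) * iexp (s * Y \<omega>))" for s
    by (rule integrable_const_bound[of _ C], auto simp: norm_mult bound)+
  \<comment> \<open>Conjugation turns the frequency \<open>- s\<close> into \<open>s\<close>; since
    the hypothesis covers all frequencies, the conjugate weight satisfies it as well.\<close>
  have fourier': "(CLINT \<omega>|M. cnj (w \<omega>) * iexp (s * Y \<omega>)) = 0" for s
  proof -
    have "(CLINT \<omega>|M. cnj (w \<omega> * iexp (- s * Y \<omega>))) = 0"
      using fourier[of "- s"] by (simp only: Bochner_Integration.integral_cnj complex_cnj_zero)
    then show ?thesis by (simp add: exp_cnj)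
  qed
  have Re: "(CLINT \<omega>|M. of_real (Re (w \<omega>)) * iexp (s * Y \<omega>)) = 0" for s
  proof -
    have "(CLINT \<omega>|M. of_real (Re (w \<omega>)) * iexp (s * Y \<omega>)) =
      (CLINT \<omega>|M. (w \<omega> * iexp (s * Y \<omega>) + cnj (w \<omega>) * iexp (s * Y \<omega>)) / 2)"
      by (intro Bochner_Integration.integral_cong refl)
         (simp add: complex_add_cnj flip: distrib_right)
    then show ?thesis
      by (simp add: int fourier fourier' del: of_real_mult)
  qed
  have Im_eq: "complex_of_real (Im z) = (z - cnj z) / (2 * \<i>)" for z
    by (simp add: complex_eq_iff)
  have Im: "(CLINT \<omega>|M. of_real (Im (w \<omega>)) * iexp (s * Y \<omega>)) = 0" for s
  proof -
    have "(CLINT \<omega>|M. of_real (Im (w \<omega>)) * iexp (s * Y \<omega>)) =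
      (CLINT \<omega>|M. (w \<omega> * iexp (s * Y \<omega>) - cnj (w \<omega>) * iexp (s * Y \<omega>)) / (2 * \<i>))"
      by (intro Bochner_Integration.integral_cong refl)
         (simp add: Im_eq diff_divide_distrib left_diff_distrib)
    then show ?thesis
      by (simp add: int fourier fourier' del: of_real_mult)
  qed
  have *: "expectation (\<lambda>\<omega>. Re (w \<omega>) * indicator B (Y \<omega>)) = 0"
    by (rule expectation_indicator_eq_0_if_fourier_real[where C = C, OF _ _ _ Re B])
       (auto intro: order_trans[OF abs_Re_le_cmod bound])
  have **: "expectation (\<lambda>\<omega>. Im (w \<omega>) * indicator B (Y \<omega>)) = 0"
    by (rule expectation_indicator_eq_0_if_fourier_real[where C = C, OF _ _ _ Im B])
       (auto intro: order_trans[OF abs_Im_le_cmod bound])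
  have C0: "0 \<le> C" using bound[of undefined] norm_ge_zero order_trans by blast
  have [simp]: "integrable M (\<lambda>\<omega>. w \<omega> * indicator B (Y \<omega>))"
    by (rule integrable_const_bound[of _ C]) (auto simp: norm_mult bound indicator_def C0)
  have "Re (w \<omega> * indicator B (Y \<omega>)) = Re (w \<omega>) * indicator B (Y \<omega>)"
    "Im (w \<omega> * indicator B (Y \<omega>)) = Im (w \<omega>) * indicator B (Y \<omega>)" for \<omega>
    by (auto simp: indicator_def)
  then show ?thesis
    using * ** by (intro complex_eqI) (auto simp flip: integral_Re integral_Im)
qed

text \<open>Exponentials become indicators one coordinate at a time. The weight stays arbitrary in
  the induction because factors are moved into it: first the exponential of \<open>Y k\<close>, for
  the induction hypothesis, then the indicators already obtained, for the one-variable case.\<close>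

lemma expectation_prod_indicator_eq_0_if_fourier:
  fixes w :: "'a \<Rightarrow> complex" and Y :: "'i \<Rightarrow> 'a \<Rightarrow> real"
  assumes "finite T" and "w \<in> borel_measurable M"
    and "\<And>i. i \<in> T \<Longrightarrow> Y i \<in> borel_measurable M"
    and "\<And>\<omega>. norm (w \<omega>) \<le> C"
    and "\<And>s. (CLINT \<omega>|M. w \<omega> * iexp (\<Sum>i\<in>T. s i * Y i \<omega>)) = 0"
    and "\<And>i. i \<in> T \<Longrightarrow> B i \<in> sets borel"
  shows "(CLINT \<omega>|M. w \<omega> * (\<Prod>i\<in>T. indicator (B i) (Y i \<omega>))) = 0"
  using assms
proof (induction T arbitrary: w rule: finite_induct)
  case empty
  then show ?case by simp
next
  case (insert k T)
  have [measurable]: "w \<in> borel_measurable M" "Y k \<in> borel_measurable M" "B k \<in> sets borel"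
    and [measurable]: "\<And>i. i \<in> T \<Longrightarrow> Y i \<in> borel_measurable M" "\<And>i. i \<in> T \<Longrightarrow> B i \<in> sets borel"
    using insert.prems by auto
  have bound: "norm (w \<omega>) \<le> C" for \<omega> by (rule insert.prems)
  have C0: "0 \<le> C" using bound[of undefined] norm_ge_zero order_trans by blast
  have "(CLINT \<omega>|M. (w \<omega> * iexp (t * Y k \<omega>)) * (\<Prod>i\<in>T. indicator (B i) (Y i \<omega>))) = 0" for t
  proof (rule insert.IH)
    fix s :: "'i \<Rightarrow> real"
    \<comment> \<open>Since \<open>k\<close> is not in \<open>T\<close>, its frequency can be set to
      \<open>t\<close> without changing the sum over \<open>T\<close>.\<close>
    have "(\<Sum>i\<in>T. (s(k := t)) i * Y i \<omega>) = (\<Sum>i\<in>T. s i * Y i \<omega>)" for \<omega>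
      using insert.hyps by (intro sum.cong) auto
    then have "iexp (\<Sum>i\<in>insert k T. (s(k := t)) i * Y i \<omega>) =
        iexp (t * Y k \<omega>) * iexp (\<Sum>i\<in>T. s i * Y i \<omega>)" for \<omega>
      using insert.hyps by (simp add: exp_add distrib_left del: fun_upd_apply) simp
    then show "(CLINT \<omega>|M. (w \<omega> * iexp (t * Y k \<omega>)) * iexp (\<Sum>i\<in>T. s i * Y i \<omega>)) = 0"
      using insert.prems(4)[of "s(k := t)"] by (simp only: mult.assoc)
  qed (auto simp: norm_mult bound)
  then have "(CLINT \<omega>|M. (w \<omega> * (\<Prod>i\<in>T. indicator (B i) (Y i \<omega>))) * indicator (B k) (Y k \<omega>)) = 0"
  proof (intro expectation_indicator_eq_0_if_fourier)
    show "norm (w \<omega> * (\<Prod>i\<in>T. indicator (B i) (Y i \<omega>))) \<le> C" for \<omega>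
    proof -
      have "norm (\<Prod>i\<in>T. indicator (B i) (Y i \<omega>) :: complex) \<le> 1"
        unfolding prod_norm[symmetric] by (rule prod_le_1) (auto simp: indicator_def)
      then show ?thesis
        using mult_mono[OF bound[of \<omega>], of "norm (\<Prod>i\<in>T. indicator (B i) (Y i \<omega>) :: complex)" 1] C0
        by (simp add: norm_mult)
    qed
  qed (auto simp: ac_simps)
  then show ?case
    using insert.hyps by (simp add: ac_simps)
qed

text \<open>
  The exponentials are traded for indicators one variable at a time: first for \<open>V\<close> against the
  weight \<open>exp(i(s,Y)) - E exp(i(s,Y))\<close>, then for the \<open>Y i\<close> against \<open>1\<^sub>B(V) - P(V \<in> B)\<close>.
\<close>

lemma prob_vimage_Int_if_char_factorises:
  fixes V :: "'a \<Rightarrow> real" and Y :: "'i \<Rightarrow> 'a \<Rightarrow> real"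
  assumes [measurable]: "V \<in> borel_measurable M" "\<And>i. i \<in> I \<Longrightarrow> Y i \<in> borel_measurable M"
    and char: "\<And>T t s. finite T \<Longrightarrow> T \<subseteq> I \<Longrightarrow>
      (CLINT \<omega>|M. iexp (t * V \<omega> + (\<Sum>i\<in>T. s i * Y i \<omega>))) =
      (CLINT \<omega>|M. iexp (t * V \<omega>)) * (CLINT \<omega>|M. iexp (\<Sum>i\<in>T. s i * Y i \<omega>))"
    and B [measurable]: "B \<in> sets borel"
    and a: "a \<in> sigma_sets (space M) {Y i -` B \<inter> space M | i B. i \<in> I \<and> B \<in> sets borel}"
  shows "prob ((V -` B \<inter> space M) \<inter> a) = prob (V -` B \<inter> space M) * prob a"
proof -
  \<comment> \<open>Finite cylinders form an intersection-stable generator of the sigma-field of the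
    family, on which the product formula can be checked directly.\<close>
  define P where "P = {{\<omega> \<in> space M. \<forall>i\<in>T. Y i \<omega> \<in> C i} | T C.
    finite T \<and> T \<subseteq> I \<and> (\<forall>i. C i \<in> sets borel)}"
  have P_events: "P \<subseteq> events"
  proof
    fix p assume "p \<in> P"
    then obtain T C where p: "p = {\<omega> \<in> space M. \<forall>i\<in>T. Y i \<omega> \<in> C i}"
      and T: "finite T" "T \<subseteq> I" and [measurable]: "\<And>i. C i \<in> sets borel"
      unfolding P_def by blast
    have [measurable]: "\<And>i. i \<in> T \<Longrightarrow> Y i \<in> borel_measurable M"
      using T by auto
    show "p \<in> events"
      unfolding p using T(1) by measurable
  qed
  have stable: "Int_stable P"
  proof (rule Int_stableI)
    fix p q assume "p \<in> P" "q \<in> P"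
    then obtain T C U D where p: "p = {\<omega> \<in> space M. \<forall>i\<in>T. Y i \<omega> \<in> C i}"
      "finite T" "T \<subseteq> I" "\<And>i. C i \<in> sets borel"
      and q: "q = {\<omega> \<in> space M. \<forall>i\<in>U. Y i \<omega> \<in> D i}"
      "finite U" "U \<subseteq> I" "\<And>i. D i \<in> sets borel"
      unfolding P_def by blast
    \<comment> \<open>Padding with \<open>UNIV\<close> where a coordinate is absent lets both
      cylinders be written over the common index set.\<close>
    define G where "G i = (if i \<in> T then C i else UNIV) \<inter> (if i \<in> U then D i else UNIV)" for i
    have "p \<inter> q = {\<omega> \<in> space M. \<forall>i\<in>T \<union> U. Y i \<omega> \<in> G i}"
      unfolding p q G_def by auto
    moreover have "G i \<in> sets borel" for i
      unfolding G_def using p(4) q(4) by auto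
    ultimately show "p \<inter> q \<in> P"
      unfolding P_def using p(2,3) q(2,3)
      by (intro CollectI exI[of _ "T \<union> U"] exI[of _ G] conjI allI) simp_all
  qed
  have prod: "prob ((V -` B \<inter> space M) \<inter> p) = prob (V -` B \<inter> space M) * prob p"
    if "p \<in> P" and B [measurable]: "B \<in> sets borel" for p B
  proof -
    from \<open>p \<in> P\<close> obtain T C where p: "p = {\<omega> \<in> space M. \<forall>i\<in>T. Y i \<omega> \<in> C i}"
      and T: "finite T" "T \<subseteq> I" and C [measurable]: "\<And>i. C i \<in> sets borel"
      unfolding P_def by blast
    have [measurable]: "\<And>i. i \<in> T \<Longrightarrow> Y i \<in> borel_measurable M"
      using T by auto
    have [measurable]: "p \<in> events" using P_events \<open>p \<in> P\<close> by auto
    define b where "b = prob (V -` B \<inter> space M)"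
    have int: "integrable M (\<lambda>\<omega>. iexp (f \<omega>))" if "f \<in> borel_measurable M" for f :: "'a \<Rightarrow> real"
      using that by (intro integrable_const_bound[of _ 1]) auto
    have ind: "(\<lambda>\<omega>. indicator B (V \<omega>) :: complex) \<in> borel_measurable M" by measurable
    have int_ind: "integrable M (\<lambda>\<omega>. indicator B (V \<omega>) :: complex)"
      by (intro integrable_const_bound[of _ 1] ind) (auto simp: indicator_def)
    have int_real: "integrable M (indicator S :: 'a \<Rightarrow> real)" if "S \<in> events" for S
      using that by (intro integrable_const_bound[of _ 1]) auto
    have Eind: "(CLINT \<omega>|M. indicator B (V \<omega>)) = of_real b"
    proof -
      have "(CLINT \<omega>|M. indicator B (V \<omega>)) =
          (CLINT \<omega>|M. of_real (indicator (V -` B \<inter> space M) \<omega>))"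
        by (intro Bochner_Integration.integral_cong) (auto simp: indicator_def)
      then show ?thesis by (simp only: integral_of_real) (simp add: b_def)
    qed
    \<comment> \<open>With the probability \<open>b\<close> subtracted, the vanishing of this
      integral is exactly the product formula for the cylinder \<open>p\<close>.\<close>
    have "(CLINT \<omega>|M. (indicator B (V \<omega>) - of_real b) * (\<Prod>i\<in>T. indicator (C i) (Y i \<omega>))) = 0"
    proof (rule expectation_prod_indicator_eq_0_if_fourier[OF T(1)])
      fix s :: "'i \<Rightarrow> real"
      let ?e = "\<lambda>\<omega>. iexp (\<Sum>i\<in>T. s i * Y i \<omega>)"
      define c where "c = (CLINT \<omega>|M. ?e \<omega>)"
      have int_e: "integrable M ?e" by (rule int) measurable
      have "(CLINT \<omega>|M. (?e \<omega> - c) * indicator B (V \<omega>)) = 0"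
      proof (rule expectation_indicator_eq_0_if_fourier)
        show "norm (?e \<omega> - c) \<le> 1 + norm c" for \<omega>
          by (rule order_trans[OF norm_triangle_ineq4]) simp
        fix t
        have int1: "integrable M (\<lambda>\<omega>. iexp (t * V \<omega> + (\<Sum>i\<in>T. s i * Y i \<omega>)))"
          by (rule int) measurable
        have int2: "integrable M (\<lambda>\<omega>. iexp (t * V \<omega>))"
          by (rule int) measurable
        have "(CLINT \<omega>|M. (?e \<omega> - c) * iexp (t * V \<omega>)) =
          (CLINT \<omega>|M. iexp (t * V \<omega> + (\<Sum>i\<in>T. s i * Y i \<omega>)) - c * iexp (t * V \<omega>))"
          by (intro Bochner_Integration.integral_cong refl) (simp add: algebra_simps exp_add)
        also have "\<dots> = (CLINT \<omega>|M. iexp (t * V \<omega> + (\<Sum>i\<in>T. s i * Y i \<omega>))) -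
            c * (CLINT \<omega>|M. iexp (t * V \<omega>))"
          using int1 int2 by (simp only: Bochner_Integration.integral_diff integrable_mult_right
              integral_mult_right_zero)
        also have "\<dots> = 0"
          by (simp only: char[OF T] c_def) simp
        finally show "(CLINT \<omega>|M. (?e \<omega> - c) * iexp (t * V \<omega>)) = 0" .
      qed auto
      moreover have "integrable M (\<lambda>\<omega>. ?e \<omega> * indicator B (V \<omega>))"
        by (rule integrable_const_bound[of _ 1]) (auto simp: indicator_def)
      ultimately have "(CLINT \<omega>|M. ?e \<omega> * indicator B (V \<omega>)) = c * of_real b"
        using int_ind by (simp add: left_diff_distrib Eind)
      moreover have "integrable M (\<lambda>\<omega>. indicator B (V \<omega>) * ?e \<omega>)"
        by (rule integrable_const_bound[of _ 1]) (auto simp: indicator_def)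
      ultimately show "(CLINT \<omega>|M. (indicator B (V \<omega>) - of_real b) * ?e \<omega>) = 0"
        using int_e by (simp add: left_diff_distrib c_def mult.commute)
    next
      show "norm (indicator B (V \<omega>) - complex_of_real b) \<le> 1 + \<bar>b\<bar>" for \<omega>
        by (rule order_trans[OF norm_triangle_ineq4]) (auto simp: indicator_def)
    qed auto
    moreover have prod_ind: "(\<Prod>i\<in>T. indicator (C i) (Y i \<omega>) :: complex) = indicator p \<omega>"
      if "\<omega> \<in> space M" for \<omega>
      using that T(1) by (auto simp: p indicator_def)
    ultimately have "(CLINT \<omega>|M. (indicator B (V \<omega>) - of_real b) * indicator p \<omega>) = 0"
      by (simp cong: Bochner_Integration.integral_cong)
    moreover have "(CLINT \<omega>|M. (indicator B (V \<omega>) - of_real b) * indicator p \<omega>) =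
      (CLINT \<omega>|M. of_real (indicator ((V -` B \<inter> space M) \<inter> p) \<omega> - b * indicator p \<omega>))"
      by (intro Bochner_Integration.integral_cong refl) (auto simp: indicator_def)
    moreover have "\<dots> = of_real (prob ((V -` B \<inter> space M) \<inter> p)) - of_real b * of_real (prob p)"
      using int_real[of "(V -` B \<inter> space M) \<inter> p"] int_real[of p]
      by (simp only: integral_complex_of_real Bochner_Integration.integral_diff
          integrable_mult_right) simp
    ultimately have "complex_of_real (prob ((V -` B \<inter> space M) \<inter> p) - b * prob p) = 0"
      by simp
    then show ?thesis
      unfolding b_def of_real_eq_0_iff by simp
  qed
  \<comment> \<open>The events of \<open>V\<close> and the cylinders are both stable under
    intersection, so their independence extends to the generated sigma-fields.\<close>
  let ?V = "{V -` B \<inter> space M | B. B \<in> sets borel}"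
  have "Int_stable ?V"
  proof (rule Int_stableI)
    fix a b assume "a \<in> ?V" "b \<in> ?V"
    then obtain B C where "a = V -` B \<inter> space M" "b = V -` C \<inter> space M"
      "B \<in> sets borel" "C \<in> sets borel" by auto
    then show "a \<inter> b \<in> ?V"
      by (intro CollectI exI[of _ "B \<inter> C"]) auto
  qed
  moreover have "indep_set ?V P"
    using prod P_events by (intro indep_setI) auto
  ultimately have indep: "indep_set (sigma_sets (space M) ?V) (sigma_sets (space M) P)"
    using stable by (intro indep_set_sigma_sets)
  have "{Y i -` B \<inter> space M | i B. i \<in> I \<and> B \<in> sets borel} \<subseteq> P"
  proof safe
    fix i and B :: "real set" assume "i \<in> I" "B \<in> sets borel"
    then show "Y i -` B \<inter> space M \<in> P"
      unfolding P_def by (intro CollectI exI[of _ "{i}"] exI[of _ "\<lambda>_. B"]) auto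
  qed
  then have "a \<in> sigma_sets (space M) P"
    using a sigma_sets_mono'[of _ P] by blast
  moreover have "V -` B \<inter> space M \<in> sigma_sets (space M) ?V"
    by (rule sigma_sets.Basic) auto
  ultimately show ?thesis
    using indep_setD[OF indep] by blast
qed

end

subsection \<open>Closed linear spans\<close>

lemma L2_measurable: "f \<in> L2 M \<Longrightarrow> f \<in> borel_measurable M"
  by (simp add: L2_def)

lemma L2_integrable_square: "f \<in> L2 M \<Longrightarrow> integrable M (\<lambda>\<omega>. (f \<omega>)\<^sup>2)"
  by (simp add: L2_def)

lemma L2_integrable_mult:
  assumes f: "f \<in> L2 M" and g: "g \<in> L2 M"
  shows "integrable M (\<lambda>\<omega>. f \<omega> * g \<omega>)"
proof (rule Bochner_Integration.integrable_bound)
  show "integrable M (\<lambda>\<omega>. (f \<omega>)\<^sup>2 + (g \<omega>)\<^sup>2)"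
    using f g by (intro Bochner_Integration.integrable_add L2_integrable_square)
  show "(\<lambda>\<omega>. f \<omega> * g \<omega>) \<in> borel_measurable M"
    using f g by (intro borel_measurable_times L2_measurable)
  have "\<bar>a * b\<bar> \<le> a\<^sup>2 + b\<^sup>2" for a b :: real
  proof -
    have "2 * \<bar>a * b\<bar> \<le> a\<^sup>2 + b\<^sup>2"
      using sum_squares_bound[of "\<bar>a\<bar>" "\<bar>b\<bar>"] by (simp add: abs_mult)
    then show ?thesis by linarith
  qed
  then show "AE \<omega> in M. norm (f \<omega> * g \<omega>) \<le> norm ((f \<omega>)\<^sup>2 + (g \<omega>)\<^sup>2)"
    by simp
qed

lemma L2_cmult:
  assumes "f \<in> L2 M"
  shows "(\<lambda>\<omega>. k * f \<omega>) \<in> L2 M"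
  using assms by (auto simp: L2_def power_mult_distrib)

lemma L2_add:
  assumes "f \<in> L2 M" "g \<in> L2 M"
  shows "(\<lambda>\<omega>. f \<omega> + g \<omega>) \<in> L2 M"
proof -
  have "integrable M (\<lambda>\<omega>. (f \<omega>)\<^sup>2 + (g \<omega>)\<^sup>2 + 2 * (f \<omega> * g \<omega>))"
    using assms by (intro Bochner_Integration.integrable_add integrable_mult_right L2_integrable_mult L2_integrable_square)
  moreover have "(\<lambda>\<omega>. f \<omega> + g \<omega>) \<in> borel_measurable M"
    using assms by (intro borel_measurable_add L2_measurable)
  ultimately show ?thesis
    by (simp add: L2_def power2_sum mult.assoc)
qed

lemma L2_diff:
  assumes "f \<in> L2 M" "g \<in> L2 M"
  shows "(\<lambda>\<omega>. f \<omega> - g \<omega>) \<in> L2 M"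
  using L2_add[OF assms(1) L2_cmult[OF assms(2), of "- 1"]] by simp

lemma L2_lincomb:
  assumes "\<And>i. i \<in> T \<Longrightarrow> f i \<in> L2 M"
  shows "(\<lambda>\<omega>. \<Sum>i\<in>T. c i * f i \<omega>) \<in> L2 M"
  using assms
proof (induction T rule: infinite_finite_induct)
  case (insert i T)
  then show ?case
    using L2_add[OF L2_cmult[of "f i" M "c i"]] by simp
qed (auto simp: L2_def)

text \<open>The integral of the square of \<open>c * f - b * g\<close> is nonnegative and equals
  \<open>c\<close> times \<open>a * c - b\<^sup>2\<close>. Cancelling \<open>c\<close> requires a
  separate case, in which \<open>g\<close> vanishes almost everywhere.\<close>

lemma L2_Cauchy_Schwarz:
  assumes f: "f \<in> L2 M" and g: "g \<in> L2 M"
  shows "(\<integral>\<omega>. f \<omega> * g \<omega> \<partial>M)\<^sup>2 \<le> (\<integral>\<omega>. (f \<omega>)\<^sup>2 \<partial>M) * (\<integral>\<omega>. (g \<omega>)\<^sup>2 \<partial>M)"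
proof -
  define a where "a = (\<integral>\<omega>. (f \<omega>)\<^sup>2 \<partial>M)"
  define b where "b = (\<integral>\<omega>. f \<omega> * g \<omega> \<partial>M)"
  define c where "c = (\<integral>\<omega>. (g \<omega>)\<^sup>2 \<partial>M)"
  have [measurable]: "f \<in> borel_measurable M" "g \<in> borel_measurable M"
    using f g by (auto dest: L2_measurable)
  note int = L2_integrable_square[OF f] L2_integrable_square[OF g] L2_integrable_mult[OF f g]
  show ?thesis
  proof (cases "c = 0")
    case True
    then have "AE \<omega> in M. (g \<omega>)\<^sup>2 = 0"
      unfolding c_def using int by (subst (asm) integral_nonneg_eq_0_iff_AE) auto
    then have "b = (\<integral>\<omega>. 0 \<partial>M)"
      unfolding b_def by (intro integral_cong_AE) auto
    then show ?thesis
      by (simp flip: b_def)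
  next
    case False
    moreover have "c \<ge> 0"
      unfolding c_def by (rule integral_nonneg_AE) simp
    ultimately have "c > 0" by simp
    have "0 \<le> (\<integral>\<omega>. (c * f \<omega> - b * g \<omega>)\<^sup>2 \<partial>M)"
      by (rule integral_nonneg_AE) simp
    also have "\<dots> = (\<integral>\<omega>. c\<^sup>2 * (f \<omega>)\<^sup>2 - 2 * c * b * (f \<omega> * g \<omega>) + b\<^sup>2 * (g \<omega>)\<^sup>2 \<partial>M)"
      by (intro Bochner_Integration.integral_cong refl) (simp add: power2_eq_square algebra_simps)
    also have "\<dots> = c\<^sup>2 * a - 2 * c * b * b + b\<^sup>2 * c"
      unfolding a_def b_def c_def using int by simp
    also have "\<dots> = c * (a * c - b\<^sup>2)"
      by (simp add: power2_eq_square algebra_simps)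
    finally have "b\<^sup>2 \<le> a * c"
      using \<open>c > 0\<close> by (simp add: zero_le_mult_iff)
    then show ?thesis
      by (simp add: a_def b_def c_def)
  qed
qed

section \<open>Approximation in closed linear spans and their closure properties\<close>

lemma L2_span_iff:
  "f \<in> L2_span M F I \<longleftrightarrow> f \<in> L2 M \<and> (\<forall>\<epsilon>>0. \<exists>T c. finite T \<and> T \<subseteq> I \<and>
     (\<integral>\<omega>. (f \<omega> - (\<Sum>i\<in>T. c i * F i \<omega>))\<^sup>2 \<partial>M) < \<epsilon>)"
proof -
  \<comment> \<open>Exchanging the thresholds \<epsilon> and \<open>\<epsilon>\<^sup>2\<close>
    removes the square root, so that all later estimates can use squared errors.\<close>
  have sqrt: "sqrt x < \<epsilon> \<longleftrightarrow> x < \<epsilon>\<^sup>2" if "\<epsilon> > 0" for x \<epsilon> :: real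
    using that real_sqrt_less_iff[of x "\<epsilon>\<^sup>2"] by simp
  show ?thesis
    unfolding L2_span_def mem_Collect_eq
  proof (intro conj_cong refl iffI allI impI)
    fix \<epsilon> :: real
    assume *: "\<forall>\<epsilon>>0. \<exists>T c. finite T \<and> T \<subseteq> I \<and>
      sqrt (\<integral>\<omega>. (f \<omega> - (\<Sum>i\<in>T. c i * F i \<omega>))\<^sup>2 \<partial>M) < \<epsilon>" and "\<epsilon> > 0"
    then show "\<exists>T c. finite T \<and> T \<subseteq> I \<and> (\<integral>\<omega>. (f \<omega> - (\<Sum>i\<in>T. c i * F i \<omega>))\<^sup>2 \<partial>M) < \<epsilon>"
      using *[rule_format, of "sqrt \<epsilon>"] by simp
  next
    fix \<epsilon> :: real
    assume *: "\<forall>\<epsilon>>0. \<exists>T c. finite T \<and> T \<subseteq> I \<and>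
      (\<integral>\<omega>. (f \<omega> - (\<Sum>i\<in>T. c i * F i \<omega>))\<^sup>2 \<partial>M) < \<epsilon>" and "\<epsilon> > 0"
    then show "\<exists>T c. finite T \<and> T \<subseteq> I \<and> sqrt (\<integral>\<omega>. (f \<omega> - (\<Sum>i\<in>T. c i * F i \<omega>))\<^sup>2 \<partial>M) < \<epsilon>"
      using *[rule_format, of "\<epsilon>\<^sup>2"] by (simp add: sqrt)
  qed
qed

lemma L2_span_L2: "f \<in> L2_span M F I \<Longrightarrow> f \<in> L2 M"
  by (simp add: L2_span_def)

lemma L2_span_base:
  assumes "i \<in> I" "F i \<in> L2 M"
  shows "F i \<in> L2_span M F I"
  using assms unfolding L2_span_iff
  by (auto intro!: exI[of _ "{i}"] exI[of _ "\<lambda>_. 1"])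

lemma L2_span_cmult:
  assumes f: "f \<in> L2_span M F I"
  shows "(\<lambda>\<omega>. k * f \<omega>) \<in> L2_span M F I"
  unfolding L2_span_iff
proof (intro conjI allI impI)
  show "(\<lambda>\<omega>. k * f \<omega>) \<in> L2 M"
    using f by (intro L2_cmult L2_span_L2)
  fix \<epsilon> :: real assume "\<epsilon> > 0"
  \<comment> \<open>Using \<open>k\<^sup>2 + 1\<close> in place of \<open>k\<^sup>2\<close> keeps
    the denominator positive when \<open>k = 0\<close>.\<close>
  then have "\<epsilon> / (k\<^sup>2 + 1) > 0" by (simp add: add_nonneg_pos)
  then obtain T c where T: "finite T" "T \<subseteq> I"
    and lt: "(\<integral>\<omega>. (f \<omega> - (\<Sum>i\<in>T. c i * F i \<omega>))\<^sup>2 \<partial>M) < \<epsilon> / (k\<^sup>2 + 1)"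
    using f unfolding L2_span_iff by blast
  have "(\<integral>\<omega>. (k * f \<omega> - (\<Sum>i\<in>T. (k * c i) * F i \<omega>))\<^sup>2 \<partial>M) =
    (\<integral>\<omega>. k\<^sup>2 * (f \<omega> - (\<Sum>i\<in>T. c i * F i \<omega>))\<^sup>2 \<partial>M)"
    by (simp add: sum_distrib_left right_diff_distrib mult.assoc flip: power_mult_distrib)
  also have "\<dots> = k\<^sup>2 * (\<integral>\<omega>. (f \<omega> - (\<Sum>i\<in>T. c i * F i \<omega>))\<^sup>2 \<partial>M)"
    by simp
  also have "\<dots> \<le> (k\<^sup>2 + 1) * (\<integral>\<omega>. (f \<omega> - (\<Sum>i\<in>T. c i * F i \<omega>))\<^sup>2 \<partial>M)"
    by (intro mult_right_mono integral_nonneg_AE) auto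
  also have "\<dots> < \<epsilon>"
    using lt by (simp add: pos_less_divide_eq add_nonneg_pos mult.commute)
  finally show "\<exists>T c. finite T \<and> T \<subseteq> I \<and> (\<integral>\<omega>. (k * f \<omega> - (\<Sum>i\<in>T. c i * F i \<omega>))\<^sup>2 \<partial>M) < \<epsilon>"
    using T by (intro exI[of _ T] exI[of _ "\<lambda>i. k * c i"]) simp
qed

text \<open>The inequality \<open>(p + q)\<^sup>2 \<le> 2 * p\<^sup>2 + 2 * q\<^sup>2\<close>
  replaces the triangle inequality, so a squared error below a quarter of \<epsilon> for each
  summand suffices.\<close>

lemma L2_span_add:
  assumes F: "\<And>i. i \<in> I \<Longrightarrow> F i \<in> L2 M"
    and f: "f \<in> L2_span M F I" and g: "g \<in> L2_span M F I"
  shows "(\<lambda>\<omega>. f \<omega> + g \<omega>) \<in> L2_span M F I"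
  unfolding L2_span_iff
proof (intro conjI allI impI)
  show "(\<lambda>\<omega>. f \<omega> + g \<omega>) \<in> L2 M"
    using f g by (intro L2_add L2_span_L2)
  fix \<epsilon> :: real assume "\<epsilon> > 0"
  then have "\<epsilon> / 4 > 0" by simp
  then obtain T c where T: "finite T" "T \<subseteq> I"
    and lt_f: "(\<integral>\<omega>. (f \<omega> - (\<Sum>i\<in>T. c i * F i \<omega>))\<^sup>2 \<partial>M) < \<epsilon> / 4"
    using f unfolding L2_span_iff by blast
  obtain U d where U: "finite U" "U \<subseteq> I"
    and lt_g: "(\<integral>\<omega>. (g \<omega> - (\<Sum>i\<in>U. d i * F i \<omega>))\<^sup>2 \<partial>M) < \<epsilon> / 4"
    using g \<open>\<epsilon> / 4 > 0\<close> unfolding L2_span_iff by blast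
  let ?p = "\<lambda>\<omega>. f \<omega> - (\<Sum>i\<in>T. c i * F i \<omega>)"
  let ?q = "\<lambda>\<omega>. g \<omega> - (\<Sum>i\<in>U. d i * F i \<omega>)"
  \<comment> \<open>Both coefficient families are extended by zero to the union of the index sets;
    on the overlap they add up.\<close>
  define e where "e i = (if i \<in> T then c i else 0) + (if i \<in> U then d i else 0)" for i
  have p: "?p \<in> L2 M" and q: "?q \<in> L2 M"
    using T U F by (auto intro!: L2_diff L2_lincomb L2_span_L2[OF f] L2_span_L2[OF g])
  have "(\<Sum>i\<in>T \<union> U. (if i \<in> T then c i else 0) * F i \<omega>) = (\<Sum>i\<in>T. c i * F i \<omega>)"
    "(\<Sum>i\<in>T \<union> U. (if i \<in> U then d i else 0) * F i \<omega>) = (\<Sum>i\<in>U. d i * F i \<omega>)" for \<omega>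
    using T U by (auto intro!: sum.mono_neutral_cong_right)
  then have sum_e: "f \<omega> + g \<omega> - (\<Sum>i\<in>T \<union> U. e i * F i \<omega>) = ?p \<omega> + ?q \<omega>" for \<omega>
    by (simp add: e_def distrib_right sum.distrib)
  have "(\<integral>\<omega>. (?p \<omega> + ?q \<omega>)\<^sup>2 \<partial>M) \<le> (\<integral>\<omega>. 2 * (?p \<omega>)\<^sup>2 + 2 * (?q \<omega>)\<^sup>2 \<partial>M)"
  proof (rule integral_mono)
    show "(?p \<omega> + ?q \<omega>)\<^sup>2 \<le> 2 * (?p \<omega>)\<^sup>2 + 2 * (?q \<omega>)\<^sup>2" for \<omega>
      using sum_squares_bound[of "?p \<omega>" "?q \<omega>"] by (simp add: power2_sum)
  qed (intro Bochner_Integration.integrable_add integrable_mult_right L2_integrable_square L2_add p q)+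
  also have "\<dots> = 2 * (\<integral>\<omega>. (?p \<omega>)\<^sup>2 \<partial>M) + 2 * (\<integral>\<omega>. (?q \<omega>)\<^sup>2 \<partial>M)"
    using L2_integrable_square[OF p] L2_integrable_square[OF q] by simp
  also have "\<dots> < \<epsilon>"
    using lt_f lt_g by simp
  finally show "\<exists>T c. finite T \<and> T \<subseteq> I \<and>
      (\<integral>\<omega>. (f \<omega> + g \<omega> - (\<Sum>i\<in>T. c i * F i \<omega>))\<^sup>2 \<partial>M) < \<epsilon>"
    using T U by (intro exI[of _ "T \<union> U"] exI[of _ e]) (simp add: sum_e)
qed

text \<open>Infinite \<open>K\<close> is covered because the sum is then zero by convention, and the
  zero function is the empty combination.\<close>

lemma L2_span_lincomb:
  assumes "\<And>i. i \<in> I \<Longrightarrow> F i \<in> L2 M"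
    and "\<And>k. k \<in> K \<Longrightarrow> f k \<in> L2_span M F I"
  shows "(\<lambda>\<omega>. \<Sum>k\<in>K. c k * f k \<omega>) \<in> L2_span M F I"
  using assms(2)
proof (induction K rule: infinite_finite_induct)
  case (insert k K)
  then show ?case
    using L2_span_add[OF assms(1) L2_span_cmult[of "f k" M F I "c k"]] by simp
qed (auto simp: L2_span_iff L2_def intro!: exI[of _ "{}"])

text \<open>Taking the squared error below \<open>1 / (n + 1)\<close> at stage \<open>n\<close>
  gives an approximating sequence, the form in which limit arguments use membership in the
  span.\<close>

lemma L2_span_sequence:
  assumes "f \<in> L2_span M F I"
  obtains T c where "\<And>n::nat. finite (T n)" "\<And>n. T n \<subseteq> I"
    "(\<lambda>n. \<integral>\<omega>. (f \<omega> - (\<Sum>i\<in>T n. c n i * F i \<omega>))\<^sup>2 \<partial>M) \<longlonglongrightarrow> 0"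
proof -
  have "\<forall>n. \<exists>T c. finite T \<and> T \<subseteq> I \<and>
      (\<integral>\<omega>. (f \<omega> - (\<Sum>i\<in>T. c i * F i \<omega>))\<^sup>2 \<partial>M) < inverse (real (Suc n))"
    using assms unfolding L2_span_iff by simp
  from choice[OF this] obtain T where "\<forall>n. \<exists>c. finite (T n) \<and> T n \<subseteq> I \<and>
      (\<integral>\<omega>. (f \<omega> - (\<Sum>i\<in>T n. c i * F i \<omega>))\<^sup>2 \<partial>M) < inverse (real (Suc n))" ..
  from choice[OF this] obtain c where *: "\<And>n. finite (T n)" "\<And>n. T n \<subseteq> I"
    "\<And>n. (\<integral>\<omega>. (f \<omega> - (\<Sum>i\<in>T n. c n i * F i \<omega>))\<^sup>2 \<partial>M) < inverse (real (Suc n))"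
    by blast
  have "(\<lambda>n. \<integral>\<omega>. (f \<omega> - (\<Sum>i\<in>T n. c n i * F i \<omega>))\<^sup>2 \<partial>M) \<longlonglongrightarrow> 0"
    by (rule tendsto_sandwich[OF _ _ tendsto_const LIMSEQ_inverse_real_of_nat])
       (auto intro!: always_eventually less_imp_le *(3) simp del: of_nat_Suc)
  with *(1,2) show ?thesis by (rule that)
qed

text \<open>Finite combinations are orthogonal to \<open>g\<close>, so the inner product of
  \<open>f\<close> with \<open>g\<close> is that of the approximation error with \<open>g\<close>,
  which Cauchy-Schwarz sends to zero.\<close>

lemma L2_span_orthogonal:
  assumes F: "\<And>i. i \<in> I \<Longrightarrow> F i \<in> L2 M" and g: "g \<in> L2 M"
    and orth: "\<And>i. i \<in> I \<Longrightarrow> (\<integral>\<omega>. F i \<omega> * g \<omega> \<partial>M) = 0"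
    and f: "f \<in> L2_span M F I"
  shows "(\<integral>\<omega>. f \<omega> * g \<omega> \<partial>M) = 0"
proof -
  obtain T c where T: "\<And>n::nat. finite (T n)" "\<And>n. T n \<subseteq> I"
    and lim: "(\<lambda>n. \<integral>\<omega>. (f \<omega> - (\<Sum>i\<in>T n. c n i * F i \<omega>))\<^sup>2 \<partial>M) \<longlonglongrightarrow> 0"
    by (rule L2_span_sequence[OF f], rule that)
  have "(\<integral>\<omega>. f \<omega> * g \<omega> \<partial>M)\<^sup>2 \<le>
      (\<integral>\<omega>. (f \<omega> - (\<Sum>i\<in>T n. c n i * F i \<omega>))\<^sup>2 \<partial>M) * (\<integral>\<omega>. (g \<omega>)\<^sup>2 \<partial>M)" for n
  proof -
    have u: "(\<lambda>\<omega>. \<Sum>i\<in>T n. c n i * F i \<omega>) \<in> L2 M"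
      using T F by (intro L2_lincomb) auto
    have "integrable M (\<lambda>\<omega>. c n i * (F i \<omega> * g \<omega>))" if "i \<in> T n" for i
      using that T F g by (intro integrable_mult_right L2_integrable_mult) auto
    moreover have "(\<integral>\<omega>. F i \<omega> * g \<omega> \<partial>M) = 0" if "i \<in> T n" for i
      using that T orth by blast
    ultimately have "(\<integral>\<omega>. (\<Sum>i\<in>T n. c n i * F i \<omega>) * g \<omega> \<partial>M) = 0"
      by (simp add: sum_distrib_right mult.assoc)
    then have "(\<integral>\<omega>. f \<omega> * g \<omega> \<partial>M) = (\<integral>\<omega>. (f \<omega> - (\<Sum>i\<in>T n. c n i * F i \<omega>)) * g \<omega> \<partial>M)"
      using L2_integrable_mult[OF L2_span_L2[OF f] g] L2_integrable_mult[OF u g]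
      by (simp add: left_diff_distrib)
    then show ?thesis
      using L2_Cauchy_Schwarz[OF L2_diff[OF L2_span_L2[OF f] u] g] by simp
  qed
  then have "(\<integral>\<omega>. f \<omega> * g \<omega> \<partial>M)\<^sup>2 \<le> 0 * (\<integral>\<omega>. (g \<omega>)\<^sup>2 \<partial>M)"
    by (intro LIMSEQ_le_const[OF tendsto_mult_right[OF lim]]) auto
  then show ?thesis by simp
qed

text \<open>The approximating combinations are measurable for \<open>N\<close>. A subsequence
  converges almost surely, and its pointwise limit is the required version.\<close>

lemma L2_span_ae_measurable:
  assumes F: "\<And>i. i \<in> I \<Longrightarrow> F i \<in> L2 M"
    and N: "\<And>i. i \<in> I \<Longrightarrow> F i \<in> borel_measurable N"
    and f: "f \<in> L2_span M F I"
  shows "ae_measurable M N f"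
proof -
  obtain T c where T: "\<And>n::nat. finite (T n)" "\<And>n. T n \<subseteq> I"
    and lim: "(\<lambda>n. \<integral>\<omega>. (f \<omega> - (\<Sum>i\<in>T n. c n i * F i \<omega>))\<^sup>2 \<partial>M) \<longlonglongrightarrow> 0"
    by (rule L2_span_sequence[OF f], rule that)
  define u where "u n \<omega> = (\<Sum>i\<in>T n. c n i * F i \<omega>)" for n \<omega>
  have u: "u n \<in> L2 M" for n
    unfolding u_def using T F by (intro L2_lincomb) auto
  have uN: "u n \<in> borel_measurable N" for n
    unfolding u_def using T N by (intro borel_measurable_sum borel_measurable_times) auto
  have "\<exists>r::nat\<Rightarrow>nat. strict_mono r \<and> (AE \<omega> in M. (\<lambda>n. (f \<omega> - u (r n) \<omega>)\<^sup>2) \<longlonglongrightarrow> 0)"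
    using lim by (intro tendsto_L1_AE_subseq L2_integrable_square[OF L2_diff[OF L2_span_L2[OF f] u]])
      (simp add: u_def)
  then obtain r :: "nat \<Rightarrow> nat" where r: "AE \<omega> in M. (\<lambda>n. (f \<omega> - u (r n) \<omega>)\<^sup>2) \<longlonglongrightarrow> 0"
    by blast
  \<comment> \<open>Where the sequence diverges the value of \<open>lim\<close> is unspecified. The
    function is measurable all the same, and divergence is confined to a null set.\<close>
  have "(\<lambda>\<omega>. lim (\<lambda>n. u (r n) \<omega>)) \<in> borel_measurable N"
    using uN by (intro borel_measurable_lim_metric)
  moreover from r have "AE \<omega> in M. f \<omega> = lim (\<lambda>n. u (r n) \<omega>)"
  proof eventually_elim
    case (elim \<omega>)
    then have "(\<lambda>n. f \<omega> - u (r n) \<omega>) \<longlonglongrightarrow> 0"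
      using tendsto_real_sqrt[OF elim] by (simp add: tendsto_rabs_zero_iff)
    then have "(\<lambda>n. f \<omega> - (f \<omega> - u (r n) \<omega>)) \<longlonglongrightarrow> f \<omega> - 0"
      by (intro tendsto_diff tendsto_const)
    then show ?case by (simp add: limI)
  qed
  ultimately show ?thesis
    unfolding ae_measurable_def by (intro bexI)
qed

section \<open>Characteristic functions of Gaussian variables and of their L2 limits\<close>

lemma norm_iexp_diff_le: "norm (iexp a - iexp b) \<le> \<bar>a - b\<bar>"
proof -
  \<comment> \<open>The factor \<open>iexp b\<close> has modulus one, which leaves the Taylor
    remainder of order zero at \<open>a - b\<close>.\<close>
  have "iexp a - iexp b = iexp b * (iexp (a - b) - 1)"
    by (simp add: algebra_simps flip: exp_add)
  then show ?thesis
    using iexp_approx1[of "a - b" 0] by (simp add: norm_mult)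
qed

context prob_space
begin

text \<open>This is Cauchy-Schwarz against the constant 1, whose norm is one for a probability
  measure.\<close>

lemma expectation_square_le:
  assumes "f \<in> L2 M"
  shows "(expectation f)\<^sup>2 \<le> expectation (\<lambda>\<omega>. (f \<omega>)\<^sup>2)"
  using L2_Cauchy_Schwarz[OF assms, of "\<lambda>_. 1"] by (simp add: L2_def prob_space)

lemma L2_integrable: "f \<in> L2 M \<Longrightarrow> integrable M f"
  using L2_integrable_mult[of f M "\<lambda>_. 1"] by (simp add: L2_def)

text \<open>A constant of mean zero vanishes, so the degenerate case fits the formula with variance
  zero. Otherwise \<open>Y / \<sigma>\<close> is standard normal, and its characteristic function is
  evaluated at \<sigma>.\<close>

lemma gaussian_rv_char:
  assumes Y: "gaussian_rv M Y" and mean: "expectation Y = 0"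
  shows "(CLINT \<omega>|M. iexp (Y \<omega>)) = of_real (exp (- expectation (\<lambda>\<omega>. (Y \<omega>)\<^sup>2) / 2))"
proof -
  have [measurable]: "Y \<in> borel_measurable M"
    using Y by (simp add: gaussian_rv_def)
  consider \<mu> where "AE \<omega> in M. Y \<omega> = \<mu>"
    | \<mu> \<sigma> where "\<sigma> > 0" "distributed M lborel Y (\<lambda>x. ennreal (normal_density \<mu> \<sigma> x))"
    using Y by (auto simp: gaussian_rv_def)
  then show ?thesis
  proof cases
    case (1 \<mu>)
    then have "expectation Y = expectation (\<lambda>_. \<mu>)"
      by (intro integral_cong_AE) auto
    then have [simp]: "\<mu> = 0"
      using mean by (simp add: prob_space)
    have "(CLINT \<omega>|M. iexp (Y \<omega>)) = (CLINT \<omega>|M. 1)"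
      using 1 by (intro integral_cong_AE) auto
    moreover have "expectation (\<lambda>\<omega>. (Y \<omega>)\<^sup>2) = expectation (\<lambda>_. 0)"
      using 1 by (intro integral_cong_AE) auto
    ultimately show ?thesis
      by (simp add: prob_space)
  next
    case (2 \<mu> \<sigma>)
    then have [simp]: "\<mu> = 0"
      using mean normal_distributed_expectation by blast
    have var: "expectation (\<lambda>\<omega>. (Y \<omega>)\<^sup>2) = \<sigma>\<^sup>2"
      using normal_distributed_variance[OF 2] mean by simp
    have "distributed M lborel (\<lambda>\<omega>. Y \<omega> / \<sigma>) std_normal_density"
      using 2 normal_standard_normal_convert[of \<sigma> Y 0] by simp
    then have "distr M lborel (\<lambda>\<omega>. Y \<omega> / \<sigma>) = std_normal_distribution"
      by (rule distributed_distr_eq_density)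
    then have "char (distr M lborel (\<lambda>\<omega>. Y \<omega> / \<sigma>)) \<sigma> = of_real (exp (- \<sigma>\<^sup>2 / 2))"
      by (simp add: char_std_normal_distribution)
    moreover have "char (distr M lborel (\<lambda>\<omega>. Y \<omega> / \<sigma>)) \<sigma> = (CLINT \<omega>|M. iexp (\<sigma> * (Y \<omega> / \<sigma>)))"
      unfolding char_def by (subst integral_distr) auto
    ultimately show ?thesis
      using \<open>\<sigma> > 0\<close> by (simp add: var)
  qed
qed

text \<open>On the left, \<open>iexp\<close> is 1-Lipschitz and the L1 norm is at most the L2 norm;
  on the right, second moments converge along an L2 convergent sequence.\<close>

lemma L2_limit_char:
  assumes f: "f \<in> L2 M" and u: "\<And>n::nat. u n \<in> L2 M"
    and lim: "(\<lambda>n. expectation (\<lambda>\<omega>. (f \<omega> - u n \<omega>)\<^sup>2)) \<longlonglongrightarrow> 0"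
    and char: "\<And>n. (CLINT \<omega>|M. iexp (u n \<omega>)) =
      of_real (exp (- expectation (\<lambda>\<omega>. (u n \<omega>)\<^sup>2) / 2))"
  shows "(CLINT \<omega>|M. iexp (f \<omega>)) = of_real (exp (- expectation (\<lambda>\<omega>. (f \<omega>)\<^sup>2) / 2))"
proof -
  have d: "(\<lambda>\<omega>. f \<omega> - u n \<omega>) \<in> L2 M" for n
    using f u by (rule L2_diff)
  have abs_d: "(\<lambda>\<omega>. \<bar>f \<omega> - u n \<omega>\<bar>) \<in> L2 M" for n
    using d[of n] by (auto simp: L2_def)
  have int: "integrable M (\<lambda>\<omega>. iexp (g \<omega>))" if "g \<in> L2 M" for g
    using L2_measurable[OF that] by (intro integrable_const_bound[of _ 1]) auto
  have "(\<lambda>n. (CLINT \<omega>|M. iexp (u n \<omega>)) - (CLINT \<omega>|M. iexp (f \<omega>))) \<longlonglongrightarrow> 0"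
  proof (rule Lim_null_comparison)
    show "\<forall>\<^sub>F n in sequentially. norm ((CLINT \<omega>|M. iexp (u n \<omega>)) - (CLINT \<omega>|M. iexp (f \<omega>)))
        \<le> sqrt (expectation (\<lambda>\<omega>. (f \<omega> - u n \<omega>)\<^sup>2))"
    proof (intro always_eventually allI)
      fix n
      have "norm ((CLINT \<omega>|M. iexp (u n \<omega>)) - (CLINT \<omega>|M. iexp (f \<omega>))) =
          norm (CLINT \<omega>|M. iexp (u n \<omega>) - iexp (f \<omega>))"
        by (simp only: Bochner_Integration.integral_diff int u f)
      also have "\<dots> \<le> expectation (\<lambda>\<omega>. norm (iexp (u n \<omega>) - iexp (f \<omega>)))"
        by (rule integral_norm_bound)
      also have "\<dots> \<le> expectation (\<lambda>\<omega>. \<bar>f \<omega> - u n \<omega>\<bar>)"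
        by (intro integral_mono Bochner_Integration.integrable_diff integrable_norm int u f
            L2_integrable abs_d) (subst abs_minus_commute, rule norm_iexp_diff_le)
      also have "\<dots> \<le> sqrt (expectation (\<lambda>\<omega>. (f \<omega> - u n \<omega>)\<^sup>2))"
        using expectation_square_le[OF abs_d[of n]] by (intro real_le_rsqrt) simp
      finally show "norm ((CLINT \<omega>|M. iexp (u n \<omega>)) - (CLINT \<omega>|M. iexp (f \<omega>))) \<le> \<dots>" .
    qed
    show "(\<lambda>n. sqrt (expectation (\<lambda>\<omega>. (f \<omega> - u n \<omega>)\<^sup>2))) \<longlonglongrightarrow> 0"
      using tendsto_real_sqrt[OF lim] by simp
  qed
  then have lim1: "(\<lambda>n. CLINT \<omega>|M. iexp (u n \<omega>)) \<longlonglongrightarrow> (CLINT \<omega>|M. iexp (f \<omega>))"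
    by (rule LIM_zero_cancel)
  have "(\<lambda>n. (expectation (\<lambda>\<omega>. f \<omega> * (f \<omega> - u n \<omega>)))\<^sup>2) \<longlonglongrightarrow> 0"
  proof (rule tendsto_sandwich[OF _ _ tendsto_const])
    show "(\<lambda>n. expectation (\<lambda>\<omega>. (f \<omega>)\<^sup>2) * expectation (\<lambda>\<omega>. (f \<omega> - u n \<omega>)\<^sup>2)) \<longlonglongrightarrow> 0"
      using tendsto_mult_left[OF lim] by simp
  qed (auto intro!: always_eventually L2_Cauchy_Schwarz f d)
  from tendsto_real_sqrt[OF this]
  have lim2: "(\<lambda>n. expectation (\<lambda>\<omega>. f \<omega> * (f \<omega> - u n \<omega>))) \<longlonglongrightarrow> 0"
    by (simp add: tendsto_rabs_zero_iff)
  \<comment> \<open>Here \<open>u n\<close> is expanded as \<open>f\<close> minus the error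
    \<open>f - u n\<close>. The cross term tends to zero by Cauchy-Schwarz, the last term by
    assumption.\<close>
  have "expectation (\<lambda>\<omega>. (u n \<omega>)\<^sup>2) = expectation (\<lambda>\<omega>. (f \<omega>)\<^sup>2) -
      2 * expectation (\<lambda>\<omega>. f \<omega> * (f \<omega> - u n \<omega>)) + expectation (\<lambda>\<omega>. (f \<omega> - u n \<omega>)\<^sup>2)" for n
  proof -
    have "expectation (\<lambda>\<omega>. (u n \<omega>)\<^sup>2) =
      expectation (\<lambda>\<omega>. (f \<omega>)\<^sup>2 - 2 * (f \<omega> * (f \<omega> - u n \<omega>)) + (f \<omega> - u n \<omega>)\<^sup>2)"
      by (intro Bochner_Integration.integral_cong refl) (simp add: power2_eq_square algebra_simps)
    then show ?thesis
      using L2_integrable_square[OF f] L2_integrable_square[OF d] L2_integrable_mult[OF f d] by simp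
  qed
  moreover have "(\<lambda>n. expectation (\<lambda>\<omega>. (f \<omega>)\<^sup>2) -
      2 * expectation (\<lambda>\<omega>. f \<omega> * (f \<omega> - u n \<omega>)) + expectation (\<lambda>\<omega>. (f \<omega> - u n \<omega>)\<^sup>2))
      \<longlonglongrightarrow> expectation (\<lambda>\<omega>. (f \<omega>)\<^sup>2) - 2 * 0 + 0"
    by (intro tendsto_intros lim lim2)
  ultimately have "(\<lambda>n. expectation (\<lambda>\<omega>. (u n \<omega>)\<^sup>2)) \<longlonglongrightarrow> expectation (\<lambda>\<omega>. (f \<omega>)\<^sup>2)"
    by simp
  then have "(\<lambda>n. complex_of_real (exp (- expectation (\<lambda>\<omega>. (u n \<omega>)\<^sup>2) / 2)))
      \<longlonglongrightarrow> of_real (exp (- expectation (\<lambda>\<omega>. (f \<omega>)\<^sup>2) / 2))"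
    by (intro tendsto_intros) auto
  then show ?thesis
    using lim1 LIMSEQ_unique unfolding char by blast
qed

text \<open>Scaling to unit variance identifies the law by its characteristic function.\<close>

lemma distr_std_normal_if_char:
  assumes f: "f \<in> L2 M" and nondeg: "\<not> (AE \<omega> in M. f \<omega> = 0)"
    and char: "\<And>t. (CLINT \<omega>|M. iexp (t * f \<omega>)) =
      of_real (exp (- (t\<^sup>2 * expectation (\<lambda>\<omega>. (f \<omega>)\<^sup>2)) / 2))"
  obtains \<sigma> where "\<sigma> > 0" "distr M borel (\<lambda>\<omega>. f \<omega> / \<sigma>) = std_normal_distribution"
proof -
  define v where "v = expectation (\<lambda>\<omega>. (f \<omega>)\<^sup>2)"
  have [measurable]: "f \<in> borel_measurable M" using f by (rule L2_measurable)
  have "v \<ge> 0" unfolding v_def by (rule integral_nonneg_AE) simp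
  moreover have "v \<noteq> 0"
    unfolding v_def using nondeg L2_integrable_square[OF f]
    by (subst integral_nonneg_eq_0_iff_AE) auto
  ultimately have "v > 0" by simp
  have "char (distr M borel (\<lambda>\<omega>. f \<omega> / sqrt v)) t = char std_normal_distribution t" for t
  proof -
    have "char (distr M borel (\<lambda>\<omega>. f \<omega> / sqrt v)) t = (CLINT \<omega>|M. iexp ((t / sqrt v) * f \<omega>))"
      unfolding char_def by (subst integral_distr) auto
    then show ?thesis
      using \<open>v > 0\<close> unfolding char char_std_normal_distribution
      by (simp add: power_divide flip: v_def)
  qed
  then have "distr M borel (\<lambda>\<omega>. f \<omega> / sqrt v) = std_normal_distribution"
    by (intro Levy_uniqueness real_dist_normal_dist ext real_distribution_distr) auto
  then show ?thesis
    using that[of "sqrt v"] \<open>v > 0\<close> by simp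
qed

end

subsection \<open>Hermite polynomials of Gaussian variables\<close>

lemma std_normal_null_if_finite:
  assumes "finite S"
  shows "measure std_normal_distribution S = 0"
proof -
  have "S \<in> null_sets lborel"
    using assms by (intro countable_imp_null_set_lborel countable_finite)
  then have "AE x in lborel. x \<notin> S"
    by (rule AE_not_in)
  then have "S \<in> null_sets std_normal_distribution"
    using \<open>S \<in> null_sets lborel\<close> by (subst null_sets_density_iff) (auto elim: AE_mp)
  then show ?thesis
    by (simp add: null_sets_def measure_def)
qed

text \<open>The normal density vanishes nowhere, so a null set of the law is Lebesgue null, and no
  nonempty open set is.\<close>

lemma std_normal_pos_if_open:
  assumes "open S" "S \<noteq> {}"
  shows "measure std_normal_distribution S > 0"
proof -
  interpret real_distribution std_normal_distribution
    by (rule real_dist_normal_dist)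
  have S: "S \<in> sets lborel" using assms by simp
  have "measure std_normal_distribution S \<noteq> 0"
  proof
    assume "measure std_normal_distribution S = 0"
    then have "S \<in> null_sets std_normal_distribution"
      using S by (simp add: null_sets_def emeasure_eq_measure)
    then have "AE x in lborel. x \<in> S \<longrightarrow> std_normal_density x = 0"
      by (subst (asm) null_sets_density_iff) auto
    moreover have "std_normal_density x \<noteq> 0" for x
      using normal_density_pos[of 1 0 x] by simp
    ultimately have "AE x in lborel. x \<notin> S"
      by simp
    then have "S \<in> null_sets lborel"
      using S by (subst (asm) AE_iff_null_sets[symmetric]) auto
    then have "negligible S"
      using negligible_iff_null_sets null_sets_completionI by blast
    then show False
      using open_not_negligible assms by blast
  qed
  then show ?thesis
    by (simp add: zero_less_measure_iff)
qed

text \<open>The Hermite function as a formal polynomial, so that arguments on coefficients and on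
  the number of roots apply.\<close>

definition hermite_poly :: "nat \<Rightarrow> real poly" where
  "hermite_poly n = smult (fact n) (\<Sum>m = 0..n div 2.
     monom ((- 1 / 2) ^ m / (fact m * fact (n - 2 * m))) (n - 2 * m))"

lemma poly_hermite_poly: "poly (hermite_poly n) x = hermite n x"
  by (simp add: hermite_poly_def hermite_def poly_sum poly_monom mult.commute)

text \<open>Only the summand with \<open>m = 0\<close> reaches degree \<open>n\<close>, and its
  coefficient \<open>1 / fact n\<close> cancels the factor \<open>fact n\<close>.\<close>

lemma coeff_hermite_poly: "coeff (hermite_poly n) n = 1"
proof -
  have "(\<Sum>m = 0..n div 2. coeff (monom ((- 1 / 2) ^ m / (fact m * fact (n - 2 * m)) :: real) (n - 2 * m)) n) =
      (\<Sum>m = 0..n div 2. if m = 0 then 1 / fact n else 0)"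
    by (intro sum.cong refl) auto
  then show ?thesis
    by (simp add: hermite_poly_def coeff_sum)
qed

text \<open>For positive \<open>n\<close>, subtracting a constant leaves the leading coefficient
  untouched, so the difference is a nonzero polynomial.\<close>

lemma finite_hermite_vimage:
  assumes "n \<noteq> 0"
  shows "finite {x. hermite n x = c}"
proof -
  have "coeff (hermite_poly n - [:c:]) n \<noteq> 0"
    using assms by (simp add: coeff_hermite_poly coeff_pCons split: nat.split)
  then have "hermite_poly n - [:c:] \<noteq> 0"
    by force
  from poly_roots_finite[OF this] show ?thesis
    by (simp add: poly_hermite_poly)
qed

lemma continuous_on_hermite: "continuous_on UNIV (hermite n)"
  unfolding poly_hermite_poly[symmetric, abs_def] by (intro continuous_intros)

lemma borel_measurable_hermite [measurable]: "hermite n \<in> borel_measurable borel"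
  by (intro borel_measurable_continuous_onI continuous_on_hermite)

text \<open>A constant function would have an infinite level set. The level \<open>c\<close>
  strictly between two values separates two nonempty open sets, which a Gaussian variable hits with
  positive probability.\<close>

lemma hermite_not_constant:
  assumes "n \<noteq> 0"
  obtains c x y where "hermite n x < c" "c < hermite n y"
proof -
  have "\<exists>y. hermite n y \<noteq> hermite n 0"
  proof (rule ccontr)
    assume "\<not> ?thesis"
    then have "{x. hermite n x = hermite n 0} = UNIV" by auto
    with finite_hermite_vimage[OF assms, of "hermite n 0"] show False
      by (simp add: infinite_UNIV_char_0)
  qed
  then obtain y where "hermite n y \<noteq> hermite n 0" ..
  then show ?thesis
    using that dense by (metis linorder_neqE)
qed

text \<open>This is the minimality of the generated sigma-field. It serves to pass from the
  sigma-field of \<open>A\<close> to a larger one.\<close>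

lemma sets_generated_sigma_subset:
  assumes "\<And>s. s \<in> A \<Longrightarrow> X s \<in> borel_measurable N" "space N = space M"
  shows "sets (generated_sigma M X A) \<subseteq> sets N"
proof -
  have "{X s -` B \<inter> space M | s B. s \<in> A \<and> B \<in> sets borel} \<subseteq> sets N"
    using assms by (auto intro: measurable_sets simp flip: assms(2))
  moreover have "space M \<in> sets N"
    using sets.top[of N] by (simp add: assms(2))
  ultimately show ?thesis
    unfolding generated_sigma_def by (subst sigma_le_sets) auto
qed

section \<open>Hermite polynomials evaluated at a nondegenerate centred Gaussian variable\<close>

context prob_space
begin

text \<open>Undoing the scaling expresses events of \<open>f\<close> through the standard normal
  law: \<open>f\<close> lies in \<open>B\<close> exactly when \<sigma> times the normalised variable
  does.\<close>

lemma std_normal_vimage: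
  assumes "distr M borel (\<lambda>\<omega>. f \<omega> / \<sigma>) = std_normal_distribution" "\<sigma> \<noteq> 0"
    and [measurable]: "f \<in> borel_measurable M" "B \<in> sets borel"
  shows "prob (f -` B \<inter> space M) = measure std_normal_distribution ((\<lambda>x. \<sigma> * x) -` B)"
proof -
  have [measurable]: "(\<lambda>x::real. \<sigma> * x) -` B \<in> sets borel"
    using measurable_sets[of "\<lambda>x::real. \<sigma> * x" borel borel B] by simp
  show ?thesis
    unfolding assms(1)[symmetric] using assms(2)
    by (subst measure_distr) (auto intro!: arg_cong[where f = prob])
qed

text \<open>There are finitely many roots, still finitely many after division by \<sigma>, and the
  standard normal law gives them no mass.\<close>

lemma AE_hermite_nonzero:
  assumes f: "f \<in> borel_measurable M"
    and \<sigma>: "distr M borel (\<lambda>\<omega>. f \<omega> / \<sigma>) = std_normal_distribution" "\<sigma> \<noteq> 0"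
    and "n \<noteq> 0"
  shows "AE \<omega> in M. hermite n (f \<omega>) \<noteq> 0"
proof -
  let ?B = "{x. hermite n x = 0}"
  have fin: "finite ?B"
    using \<open>n \<noteq> 0\<close> by (rule finite_hermite_vimage)
  have "prob (f -` ?B \<inter> space M) = 0"
    using finite_vimageI[OF fin, of "\<lambda>x. \<sigma> * x"] \<sigma>(2)
    by (subst std_normal_vimage[OF \<sigma> f])
       (auto intro!: std_normal_null_if_finite injI sets.countable countable_finite fin)
  moreover have "f -` ?B \<inter> space M \<in> events"
    using f fin by (intro measurable_sets[OF f] borel_closed finite_imp_closed)
  ultimately have "AE \<omega> in M. \<omega> \<notin> f -` ?B \<inter> space M"
    by (intro AE_not_in) (simp add: null_sets_def emeasure_eq_measure)
  then show ?thesis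
    by (auto elim!: AE_mp)
qed

text \<open>
  If \<open>hermite n f\<close> agrees almost surely with a variable independent of it, every event
  \<open>hermite n f < c\<close> is independent of itself; the full support of a Gaussian excludes this.
\<close>

lemma hermite_not_ae_measurable:
  assumes f [measurable]: "f \<in> borel_measurable M"
    and \<sigma>: "distr M borel (\<lambda>\<omega>. f \<omega> / \<sigma>) = std_normal_distribution" "\<sigma> \<noteq> 0"
    and n: "n \<noteq> 0"
    and N: "sets N \<subseteq> events" "space N = space M"
    and indep: "\<And>a B. a \<in> sets N \<Longrightarrow> B \<in> sets borel \<Longrightarrow>
      prob ((f -` B \<inter> space M) \<inter> a) = prob (f -` B \<inter> space M) * prob a"
  shows "\<not> ae_measurable M N (\<lambda>\<omega>. hermite n (f \<omega>))"
proof
  assume "ae_measurable M N (\<lambda>\<omega>. hermite n (f \<omega>))"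
  then obtain Z where ZN: "Z \<in> borel_measurable N" and ae: "AE \<omega> in M. hermite n (f \<omega>) = Z \<omega>"
    unfolding ae_measurable_def by blast
  have [measurable]: "Z \<in> borel_measurable M"
    using measurable_mono[of borel borel N M] N ZN by auto
  obtain c x y where c: "hermite n x < c" "c < hermite n y"
    by (rule hermite_not_constant[OF n])
  have open_vimage: "open {x. hermite n x < c}" "open {x. c < hermite n x}"
    by (intro open_Collect_less continuous_on_hermite continuous_on_const)+
  have scaled: "open ((\<lambda>x. \<sigma> * x) -` U)" if "open U" for U :: "real set"
    using that by (intro open_vimage continuous_intros)
  have pos: "prob (f -` U \<inter> space M) > 0" if "open U" "u \<in> U" for U u
  proof -
    have "u / \<sigma> \<in> (\<lambda>x. \<sigma> * x) -` U" using that \<sigma>(2) by simp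
    then have "(\<lambda>x. \<sigma> * x) -` U \<noteq> {}" by blast
    with scaled[OF that(1)] have "0 < measure std_normal_distribution ((\<lambda>x. \<sigma> * x) -` U)"
      by (rule std_normal_pos_if_open)
    then show ?thesis
      using that by (subst std_normal_vimage[OF \<sigma> f]) simp_all
  qed
  let ?L = "f -` {x. hermite n x < c} \<inter> space M" and ?R = "f -` {x. c < hermite n x} \<inter> space M"
  let ?a = "Z -` {..<c} \<inter> space M"
  have a: "?a \<in> sets N"
    using measurable_sets[OF ZN, of "{..<c}"] N by simp
  have "prob ?a = prob ?L"
    using ae by (intro finite_measure_eq_AE) (auto elim!: AE_mp)
  moreover have "prob (?L \<inter> ?a) = prob ?L"
    using ae by (intro finite_measure_eq_AE) (auto elim!: AE_mp)
  ultimately have "prob ?L = prob ?L * prob ?L"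
    using indep[OF a, of "{x. hermite n x < c}"] open_vimage by simp
  moreover have "prob ?L > 0"
    using c by (intro pos[of _ x] open_vimage) auto
  \<comment> \<open>The only positive solution of \<open>p = p * p\<close> is 1. This leaves no mass
    for \<open>?R\<close>, which is disjoint from \<open>?L\<close> and has positive
    probability.\<close>
  ultimately have "prob ?L = 1"
    by simp
  moreover have "prob ?R > 0"
    using c by (intro pos[of _ y] open_vimage) auto
  moreover have "prob (?L \<union> ?R) = prob ?L + prob ?R"
    by (intro finite_measure_Union) auto
  ultimately show False
    using prob_le_1[of "?L \<union> ?R"] by simp
qed

end

section \<open>Orthogonality and independence in the Gaussian space of the process\<close>

context gaussian_stationary_increment_process
begin

text \<open>Finite combinations of the process are centred Gaussian, so the formula holds for the
  approximants and passes to their L2 limit.\<close>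

lemma L2_span_char:
  assumes f: "f \<in> L2_span M X A"
  shows "(CLINT \<omega>|M. iexp (f \<omega>)) = of_real (exp (- expectation (\<lambda>\<omega>. (f \<omega>)\<^sup>2) / 2))"
proof -
  obtain T c where T: "\<And>n::nat. finite (T n)" "\<And>n. T n \<subseteq> A"
    and lim: "(\<lambda>n. expectation (\<lambda>\<omega>. (f \<omega> - (\<Sum>t\<in>T n. c n t * X t \<omega>))\<^sup>2)) \<longlonglongrightarrow> 0"
    by (rule L2_span_sequence[OF f], rule that)
  show ?thesis
  proof (rule L2_limit_char[OF L2_span_L2[OF f] _ lim])
    fix n
    show "(\<lambda>\<omega>. \<Sum>t\<in>T n. c n t * X t \<omega>) \<in> L2 M"
      using second_order by (rule L2_lincomb)
    show "(CLINT \<omega>|M. iexp (\<Sum>t\<in>T n. c n t * X t \<omega>)) =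
        of_real (exp (- expectation (\<lambda>\<omega>. (\<Sum>t\<in>T n. c n t * X t \<omega>)\<^sup>2) / 2))"
    proof (rule gaussian_rv_char)
      show "gaussian_rv M (\<lambda>\<omega>. \<Sum>t\<in>T n. c n t * X t \<omega>)"
        using gaussian T by (simp add: gaussian_process_def)
      show "expectation (\<lambda>\<omega>. \<Sum>t\<in>T n. c n t * X t \<omega>) = 0"
        using L2_integrable[OF second_order] by (simp add: zero_mean)
    qed
  qed
qed

lemma L2_span_char_scaled:
  assumes f: "f \<in> L2_span M X A"
  shows "(CLINT \<omega>|M. iexp (t * f \<omega>)) = of_real (exp (- (t\<^sup>2 * expectation (\<lambda>\<omega>. (f \<omega>)\<^sup>2)) / 2))"
  using L2_span_char[OF L2_span_cmult[OF f, of t]] by (simp only: power_mult_distrib) simp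

lemma L2_span_distr_std_normal:
  assumes f: "f \<in> L2_span M X A" and nondeg: "\<not> (AE \<omega> in M. f \<omega> = 0)"
  obtains \<sigma> where "\<sigma> > 0" "distr M borel (\<lambda>\<omega>. f \<omega> / \<sigma>) = std_normal_distribution"
  by (rule distr_std_normal_if_char[OF L2_span_L2[OF f] nondeg L2_span_char_scaled[OF f]], rule that)

text \<open>Orthogonality removes the cross term, so the second moment of \<open>t * f + g\<close>
  is the sum of those of \<open>t * f\<close> and \<open>g\<close>. All three lie in the span, where
  the second moment determines the expectation of \<open>iexp\<close>, and the exponential of the
  sum splits.\<close>

lemma L2_span_orthogonal_char:
  assumes f: "f \<in> L2_span M X A" and g: "g \<in> L2_span M X A"
    and orth: "expectation (\<lambda>\<omega>. f \<omega> * g \<omega>) = 0"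
  shows "(CLINT \<omega>|M. iexp (t * f \<omega> + g \<omega>)) =
    (CLINT \<omega>|M. iexp (t * f \<omega>)) * (CLINT \<omega>|M. iexp (g \<omega>))"
proof -
  have "expectation (\<lambda>\<omega>. (t * f \<omega> + g \<omega>)\<^sup>2) =
      expectation (\<lambda>\<omega>. t\<^sup>2 * (f \<omega>)\<^sup>2 + 2 * t * (f \<omega> * g \<omega>) + (g \<omega>)\<^sup>2)"
    by (intro Bochner_Integration.integral_cong refl) (simp add: power2_eq_square algebra_simps)
  also have "\<dots> = t\<^sup>2 * expectation (\<lambda>\<omega>. (f \<omega>)\<^sup>2) + expectation (\<lambda>\<omega>. (g \<omega>)\<^sup>2)"
    using L2_integrable_square[OF L2_span_L2[OF f]] L2_integrable_square[OF L2_span_L2[OF g]]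
      L2_integrable_mult[OF L2_span_L2[OF f] L2_span_L2[OF g]] orth by simp
  finally have var: "expectation (\<lambda>\<omega>. (t * f \<omega> + g \<omega>)\<^sup>2) = \<dots>" .
  have "(\<lambda>\<omega>. t * f \<omega> + g \<omega>) \<in> L2_span M X A"
    using second_order f g by (intro L2_span_add L2_span_cmult)
  from L2_span_char[OF this] show ?thesis
    unfolding L2_span_char[OF g] L2_span_char_scaled[OF f] var of_real_mult[symmetric] exp_add[symmetric]
    by (simp add: add_divide_distrib diff_divide_distrib)
qed

text \<open>Orthogonality to each \<open>g i\<close> extends to finite combinations, which stay in
  the span. The characteristic functions therefore factorise, which is the criterion for
  independence of the whole family.\<close>

lemma L2_span_orthogonal_indep:
  assumes f: "f \<in> L2_span M X A" and g: "\<And>i. i \<in> I \<Longrightarrow> g i \<in> L2_span M X A"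
    and orth: "\<And>i. i \<in> I \<Longrightarrow> expectation (\<lambda>\<omega>. f \<omega> * g i \<omega>) = 0"
    and B: "B \<in> sets borel"
    and a: "a \<in> sigma_sets (space M) {g i -` B \<inter> space M | i B. i \<in> I \<and> B \<in> sets borel}"
  shows "prob ((f -` B \<inter> space M) \<inter> a) = prob (f -` B \<inter> space M) * prob a"
proof (rule prob_vimage_Int_if_char_factorises[OF _ _ _ B a])
  show "f \<in> borel_measurable M" "\<And>i. i \<in> I \<Longrightarrow> g i \<in> borel_measurable M"
    using f g by (auto dest: L2_span_L2 L2_measurable)
  fix T t s assume T: "finite T" "T \<subseteq> I"
  have gL2: "g i \<in> L2 M" if "i \<in> T" for i
    using that T g L2_span_L2 by blast
  have "expectation (\<lambda>\<omega>. f \<omega> * (\<Sum>i\<in>T. s i * g i \<omega>)) =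
      expectation (\<lambda>\<omega>. \<Sum>i\<in>T. s i * (f \<omega> * g i \<omega>))"
    by (simp add: sum_distrib_left mult.left_commute)
  also have "\<dots> = (\<Sum>i\<in>T. s i * expectation (\<lambda>\<omega>. f \<omega> * g i \<omega>))"
    using L2_integrable_mult[OF L2_span_L2[OF f] gL2] by simp
  also have "\<dots> = 0"
    using T orth by (intro sum.neutral) auto
  finally show "(CLINT \<omega>|M. iexp (t * f \<omega> + (\<Sum>i\<in>T. s i * g i \<omega>))) =
      (CLINT \<omega>|M. iexp (t * f \<omega>)) * (CLINT \<omega>|M. iexp (\<Sum>i\<in>T. s i * g i \<omega>))"
    using T g second_order f by (intro L2_span_orthogonal_char L2_span_lincomb) auto
qed

end

section \<open>Measurability of Hermite products with respect to the sigma-field of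
  \<open>A\<close>\<close>

theorem theorem1p1:
  fixes M :: "'a measure" and X :: "real \<Rightarrow> 'a \<Rightarrow> real" and \<Delta> :: "real measure"
    and A :: "real set" and E :: "int \<Rightarrow> 'a \<Rightarrow> real" and J J0 :: "int set"
  assumes "gaussian_stationary_increment_process M X \<Delta>"
    and "A \<in> sets borel"
    and "orthogonal_basis M E J (L2_span M X UNIV)"
    and "J0 \<subseteq> J"
    and "orthogonal_basis M E J0 (L2_span M X A)"
  shows "\<forall>\<alpha> \<in> multi_indices J.
    ae_measurable M (generated_sigma M X A) (hermite_product E \<alpha>) \<longleftrightarrow> \<alpha> \<in> multi_indices J0"
proof (intro ballI iffI)
  interpret gaussian_stationary_increment_process M X \<Delta> by fact
  fix \<alpha> assume \<alpha>: "\<alpha> \<in> multi_indices J"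
  let ?S = "multi_index_support \<alpha>" and ?G = "generated_sigma M X A"
  have fin: "finite ?S" and S: "?S \<subseteq> J"
    using \<alpha> by (auto simp: multi_indices_def)
  have space_G: "space ?G = space M"
    by (simp add: generated_sigma_def space_measure_of_conv)
  have E_span: "E j \<in> L2_span M X UNIV" and E_nondeg: "\<not> (AE \<omega> in M. E j \<omega> = 0)"
    and E_orth: "k \<in> J \<Longrightarrow> j \<noteq> k \<Longrightarrow> expectation (\<lambda>\<omega>. E j \<omega> * E k \<omega>) = 0" if "j \<in> J" for j k
    using that assms(3) by (auto simp: orthogonal_basis_def)
  have E_L2: "E j \<in> L2 M" if "j \<in> J" for j
    using E_span[OF that] by (rule L2_span_L2)
  have X_span: "X s \<in> L2_span M X UNIV" for s
    using second_order by (intro L2_span_base) auto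
  {
    assume "\<alpha> \<in> multi_indices J0"
    then have S0: "?S \<subseteq> J0" by (simp add: multi_indices_def)
    have X_G: "X s \<in> borel_measurable ?G" if "s \<in> A" for s
    proof (rule measurableI)
      fix B :: "real set" assume "B \<in> sets borel"
      with that have "X s -` B \<inter> space M \<in> {X s -` B \<inter> space M | s B. s \<in> A \<and> B \<in> sets borel}"
        by auto
      then show "X s -` B \<inter> space ?G \<in> sets ?G"
        unfolding space_G unfolding generated_sigma_def
        by (subst sets_measure_of) (auto intro: sigma_sets.Basic)
    qed simp
    have "\<exists>Z\<in>borel_measurable ?G. AE \<omega> in M. E j \<omega> = Z \<omega>" if "j \<in> ?S" for j
    proof -
      have "E j \<in> L2_span M X A"
        using that S0 assms(5) by (auto simp: orthogonal_basis_def)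
      from L2_span_ae_measurable[OF second_order X_G this] show ?thesis
        by (simp add: ae_measurable_def)
    qed
    then obtain Z where Z: "\<And>j. j \<in> ?S \<Longrightarrow> Z j \<in> borel_measurable ?G"
      and eq: "\<And>j. j \<in> ?S \<Longrightarrow> AE \<omega> in M. E j \<omega> = Z j \<omega>"
      by metis
    \<comment> \<open>Finiteness of the support lets the exceptional null sets of the factors be
      merged into one.\<close>
    have "AE \<omega> in M. \<forall>j\<in>?S. E j \<omega> = Z j \<omega>"
      using eq fin by (simp add: AE_finite_all)
    then have "AE \<omega> in M. hermite_product E \<alpha> \<omega> = (\<Prod>j\<in>?S. hermite (\<alpha> j) (Z j \<omega>))"
      by eventually_elim (simp add: hermite_product_def)
    moreover have "(\<lambda>\<omega>. \<Prod>j\<in>?S. hermite (\<alpha> j) (Z j \<omega>)) \<in> borel_measurable ?G"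
      using Z by (intro borel_measurable_prod measurable_compose[OF _ borel_measurable_hermite])
    ultimately show "ae_measurable M ?G (hermite_product E \<alpha>)"
      unfolding ae_measurable_def by (intro bexI)
  }
  {
    assume ae: "ae_measurable M ?G (hermite_product E \<alpha>)"
    show "\<alpha> \<in> multi_indices J0"
    proof (rule ccontr)
      assume "\<alpha> \<notin> multi_indices J0"
      \<comment> \<open>The support is finite in any case, so membership can only fail through an
        index outside \<open>J0\<close>.\<close>
      then obtain j where j: "j \<in> ?S" "j \<notin> J0"
        using fin by (auto simp: multi_indices_def)
      then have jJ: "j \<in> J" using S by blast
      \<comment> \<open>The observations on \<open>A\<close> are joined with the basis elements of
        the remaining Hermite factors. Thus \<open>Z\<close> and \<open>R\<close> below are both
        measurable for \<open>N\<close>, while \<open>E j\<close> is orthogonal to every member of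
        \<open>F\<close>.\<close>
      define F where "F = X ` A \<union> E ` (?S - {j})"
      define N where "N = sigma (space M) {f -` B \<inter> space M | f B. f \<in> F \<and> B \<in> sets borel}"
      have space_N: "space N = space M"
        by (simp add: N_def space_measure_of_conv)
      have sets_N: "sets N = sigma_sets (space M) {f -` B \<inter> space M | f B. f \<in> F \<and> B \<in> sets borel}"
        unfolding N_def by (rule sets_measure_of) auto
      have F_span: "f \<in> L2_span M X UNIV" if "f \<in> F" for f
        using that X_span E_span S by (auto simp: F_def)
      have F_N: "f \<in> borel_measurable N" if "f \<in> F" for f
        using that by (intro measurableI) (auto simp: sets_N space_N intro!: sigma_sets.Basic)
      have N_events: "sets N \<subseteq> events"
        unfolding sets_N
        using F_span by (intro sets.sigma_sets_subset)
          (auto dest!: L2_span_L2 L2_measurable intro: measurable_sets)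
      \<comment> \<open>The basis property of \<open>J0\<close> places \<open>X s\<close> in the
        closed span of the \<open>E i\<close> with \<open>i\<close> in \<open>J0\<close>, and each
        of these is orthogonal to \<open>E j\<close> because \<open>j\<close> is not in
        \<open>J0\<close>.\<close>
      have X_orth: "expectation (\<lambda>\<omega>. X s \<omega> * E j \<omega>) = 0" if "s \<in> A" for s
      proof (rule L2_span_orthogonal)
        show "X s \<in> L2_span M E J0"
          using L2_span_base[of s A X M] that second_order assms(5)
          by (simp add: orthogonal_basis_def)
        show "E i \<in> L2 M" "expectation (\<lambda>\<omega>. E i \<omega> * E j \<omega>) = 0" if "i \<in> J0" for i
          using that j jJ assms(4) by (auto intro: E_L2 E_orth)
      qed (rule E_L2[OF jJ])
      have F_orth: "expectation (\<lambda>\<omega>. E j \<omega> * f \<omega>) = 0" if "f \<in> F" for f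
        using that X_orth E_orth[OF jJ] S by (auto simp: F_def mult.commute)
      \<comment> \<open>The set \<open>F\<close> is its own index set, through the identity.\<close>
      have indep: "prob ((E j -` B \<inter> space M) \<inter> a) = prob (E j -` B \<inter> space M) * prob a"
        if "a \<in> sets N" "B \<in> sets borel" for a B
        using that F_span F_orth unfolding sets_N
        by (intro L2_span_orthogonal_indep[OF E_span[OF jJ], of F "\<lambda>f. f"]) auto
      obtain \<sigma> where \<sigma>: "\<sigma> > 0" "distr M borel (\<lambda>\<omega>. E j \<omega> / \<sigma>) = std_normal_distribution"
        by (rule L2_span_distr_std_normal[OF E_span[OF jJ] E_nondeg[OF jJ]], rule that)
      \<comment> \<open>This product of the other factors is almost surely nonzero, so dividing by
        it isolates the factor that depends on \<open>E j\<close>.\<close>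
      define R where "R \<omega> = (\<Prod>k\<in>?S - {j}. hermite (\<alpha> k) (E k \<omega>))" for \<omega>
      have R_N: "R \<in> borel_measurable N"
        unfolding R_def
        by (intro borel_measurable_prod measurable_compose[OF _ borel_measurable_hermite] F_N)
           (auto simp: F_def)
      have "AE \<omega> in M. hermite (\<alpha> k) (E k \<omega>) \<noteq> 0" if "k \<in> ?S" for k
      proof -
        have k: "k \<in> J" using that S by blast
        obtain \<tau> where "\<tau> > 0" "distr M borel (\<lambda>\<omega>. E k \<omega> / \<tau>) = std_normal_distribution"
          by (rule L2_span_distr_std_normal[OF E_span[OF k] E_nondeg[OF k]], rule that)
        then show ?thesis
          using that by (intro AE_hermite_nonzero[OF L2_measurable[OF E_L2[OF k]]])
            (auto simp: multi_index_support_def)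
      qed
      then have "AE \<omega> in M. \<forall>k\<in>?S - {j}. hermite (\<alpha> k) (E k \<omega>) \<noteq> 0"
        using fin by (simp add: AE_finite_all)
      then have R_nonzero: "AE \<omega> in M. R \<omega> \<noteq> 0"
        by eventually_elim (use fin in \<open>simp add: R_def\<close>)
      obtain Z where Z: "Z \<in> borel_measurable ?G" "AE \<omega> in M. hermite_product E \<alpha> \<omega> = Z \<omega>"
        using ae unfolding ae_measurable_def by blast
      have "sets ?G \<subseteq> sets N"
        by (intro sets_generated_sigma_subset F_N space_N) (auto simp: F_def)
      then have "Z \<in> borel_measurable N"
        using measurable_mono[of borel borel ?G N] Z space_N space_G by auto
      \<comment> \<open>Division by zero yields zero, so the quotient is defined and measurable
        everywhere; zeros of \<open>R\<close> form a null set.\<close>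
      then have "(\<lambda>\<omega>. Z \<omega> / R \<omega>) \<in> borel_measurable N"
        using R_N by (rule borel_measurable_divide)
      moreover have "AE \<omega> in M. hermite (\<alpha> j) (E j \<omega>) = Z \<omega> / R \<omega>"
        using R_nonzero Z(2)
      proof eventually_elim
        case (elim \<omega>)
        have "hermite_product E \<alpha> \<omega> = hermite (\<alpha> j) (E j \<omega>) * R \<omega>"
          unfolding hermite_product_def R_def using fin j by (simp add: prod.remove)
        with elim show ?case by (simp add: field_simps)
      qed
      ultimately have "ae_measurable M N (\<lambda>\<omega>. hermite (\<alpha> j) (E j \<omega>))"
        unfolding ae_measurable_def by (intro bexI)
      moreover have "\<not> ae_measurable M N (\<lambda>\<omega>. hermite (\<alpha> j) (E j \<omega>))"
      proof (rule hermite_not_ae_measurable[OF L2_measurable[OF E_L2[OF jJ]] \<sigma>(2) _ _ N_events space_N indep])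
        show "\<sigma> \<noteq> 0" using \<sigma>(1) by simp
        show "\<alpha> j \<noteq> 0" using j by (simp add: multi_index_support_def)
      qed
      ultimately show False by contradiction
    qed
  }
qed

end
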